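(* Let $\zeta=1$, $G\in\mathbb{G}$, and let $\pi$ be an initial distribution on $\Sigma$. Then, under $\mathbb{P}^{G,\zeta}_\pi$, $$\mathbf{Z}_n\ \stackrel{d}{\longrightarrow}\ \mu_G ,$$ where $\mu_G$ is a measure on the simplex $\Delta_m$ characterized by its moments: for $1\le i\le m$, $$E_{\mu_G}(x_i)=\lim_{n\to\infty}\mathbb{E}^{G,\zeta}_\pi(Z_{i,n})=\nu_G(i),$$ and for integers $\gamma_1,\ldots,\gamma_m\ge 0$ with $\bar\gamma=\sum_{i=1}^m\gamma_i\ge 2$, $$E_{\mu_G}\big(x_1^{\gamma_1}\cdots x_m^{\gamma_m}\big)=\lim_{n\to\infty}\mathbb{E}^{G,\zeta}_\pi\big(Z_{1,n}^{\gamma_1}\cdots Z_{m,n}^{\gamma_m}\big)=\frac1{\bar\gamma}\sum_{\sigma\in\mathbb{S}(\gamma_1,\ldots,\gamma_m)}\nu_G(\sigma_1)\prod_{i=1}^{\bar\gamma-1}\big(iI-G\big)^{-1}(\sigma_i,\sigma_{i+1}).$$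
   Context: Let $\Sigma=\{1,\ldots,m\}$ with $m\ge 2$. $\mathbb{G}$ is the set of real $m\times m$ matrices $G$ with $G(i,j)>0$ for all distinct $i,j$ and $G(i,i)=-\sum_{j\ne i}G(i,j)$ (so $G(i,i)<0$). For $G\in\mathbb{G}$ and $\zeta>0$ put $n(G,\zeta)=\lceil \max_{1\le i\le m}|G(i,i)|^{1/\zeta}\rceil$ and define stochastic matrices $P^{G,\zeta}_n=I$ for $1\le n\le n(G,\zeta)$ and $P^{G,\zeta}_n=I+G/n^\zeta$ for $n\ge n(G,\zeta)+1$. For a distribution $\pi$ on $\Sigma$, $\mathbb{P}^{G,\zeta}_\pi$ (with expectation $\mathbb{E}^{G,\zeta}_\pi$) is the law on $\Sigma^{\{0,1,2,\ldots\}}$ of the time-nonhomogeneous Markov chain $(X_n)_{n\ge 0}$ with initial distribution $\pi$ and $\mathbb{P}^{G,\zeta}_\pi(X_{n+1}=j\mid X_0,\ldots,X_{n-1},X_n=i)=P^{G,\zeta}_{n+1}(i,j)$ for $n\ge0$. The occupation vector is $\mathbf{Z}_n=\langle Z_{1,n},\ldots,Z_{m,n}\rangle$ with $Z_{i,n}=\frac1n\sum_{k=1}^n 1_i(X_k)$, taking values in $\Delta_m=\{\mathbf{x}\in[0,1]^m:\sum_i x_i=1\}$. $\nu_G$ is the unique left eigenvector of $G$ for eigenvalue $0$ with positive entries summing to $1$. $E_\mu$ is expectation with respect to $\mu$. $\mathbb{S}(\gamma_1,\ldots,\gamma_m)$ is the collection of all $\bar\gamma!$ permutations $\sigma=(\sigma_1,\ldots,\sigma_{\bar\gamma})$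 of the list consisting of $\gamma_1$ copies of $1$, $\gamma_2$ copies of $2$, ..., $\gamma_m$ copies of $m$; it is counted with multiplicity, so each distinct arrangement appears $\prod_{k=1}^m\gamma_k!$ times. All eigenvalues of $G\in\mathbb{G}$ have non-positive real part, so $(xI-G)^{-1}$ is well defined for $x\ge1$. *)

theory Defs
  imports "HOL-Probability.Probability" "HOL-Combinatorics.Multiset_Permutations"
begin

definition generators :: "(real^'m^'m) set" where
  "generators = {G. (\<forall>i j. i \<noteq> j \<longrightarrow> G $ i $ j > 0) \<and>
                    (\<forall>i. G $ i $ i = - (\<Sum>j\<in>UNIV - {i}. G $ i $ j))}"

definition threshold :: "real^'m^'m \<Rightarrow> real \<Rightarrow> nat" where
  "threshold G \<zeta> = nat \<lceil>Max (range (\<lambda>i. \<bar>G $ i $ i\<bar> powr (1 / \<zeta>)))\<rceil>"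

definition transition :: "real^'m^'m \<Rightarrow> real \<Rightarrow> nat \<Rightarrow> real^'m^'m" where
  "transition G \<zeta> n =
     (if n \<le> threshold G \<zeta> then mat 1 else mat 1 + (1 / real n powr \<zeta>) *\<^sub>R G)"

abbreviation path_space :: "(nat \<Rightarrow> 'm) measure" where
  "path_space \<equiv> PiM UNIV (\<lambda>_. count_space UNIV)"

text \<open>The Markov property is stated with elementary conditional probabilities given a full
  history, hence only for histories of positive probability.\<close>

definition is_chain_law ::
    "real^'m^'m \<Rightarrow> real \<Rightarrow> 'm pmf \<Rightarrow> (nat \<Rightarrow> 'm) measure \<Rightarrow> bool" where
  "is_chain_law G \<zeta> \<pi> M \<longleftrightarrow>
     prob_space M \<and> sets M = sets path_space \<and>
     (\<forall>i. \<P>(\<omega> in M. \<omega> 0 = i) = pmf \<pi> i) \<and>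
     (\<forall>n x j. \<P>(\<omega> in M. \<forall>k\<le>n. \<omega> k = x k) > 0 \<longrightarrow>
        \<P>(\<omega> in M. \<omega> (Suc n) = j \<bar> \<forall>k\<le>n. \<omega> k = x k)
          = transition G \<zeta> (Suc n) $ x n $ j)"

text \<open>Existence and uniqueness for generators \<open>G\<close> and \<open>\<zeta> > 0\<close> are proved in
  \<open>ex1_chain_law\<close> below.\<close>

definition chain_law :: "real^'m^'m \<Rightarrow> real \<Rightarrow> 'm pmf \<Rightarrow> (nat \<Rightarrow> 'm) measure" where
  "chain_law G \<zeta> \<pi> = (THE M. is_chain_law G \<zeta> \<pi> M)"

definition occupation :: "nat \<Rightarrow> (nat \<Rightarrow> 'm) \<Rightarrow> real^'m" where
  "occupation n \<omega> = (\<chi> i. (1 / real n) * (\<Sum>k=1..n. indicator {i} (\<omega> k)))"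

definition prob_simplex :: "(real^'m) set" where
  "prob_simplex = {x. (\<forall>i. x $ i \<in> {0..1}) \<and> (\<Sum>i\<in>UNIV. x $ i) = 1}"

definition stationary :: "real^'m^'m \<Rightarrow> real^'m" where
  "stationary G =
     (THE v. v v* G = 0 \<and> (\<forall>i. v $ i > 0) \<and> (\<Sum>i\<in>UNIV. v $ i) = 1)"

text \<open>\<open>mat x\<close> is \<open>x\<close> times the identity matrix. By \<open>invertible_resolvent\<close> below, the inverse
  exists for every generator and \<open>x > 0\<close>.\<close>

definition resolvent :: "real^'m^'m \<Rightarrow> real \<Rightarrow> real^'m^'m" where
  "resolvent G x = matrix_inv (mat x - G)"

text \<open>The multiset of all rearrangements of the list with \<open>\<gamma> k\<close> copies of each letter \<open>k\<close>,
  counted with multiplicity: the copies are first labelled \<open>(k, 0), (k, 1), \<dots>\<close>, the now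
  distinct labelled copies are listed in every order, and the labels are then erased. See \<open>count_arrangements\<close>.\<close>

definition arrangements :: "('m::finite \<Rightarrow> nat) \<Rightarrow> 'm list multiset" where
  "arrangements \<gamma> =
     image_mset (map fst) (mset_set (permutations_of_set (SIGMA k:UNIV. {..<\<gamma> k})))"

text \<open>List positions start at \<open>0\<close>, so \<open>\<sigma> ! (i - 1)\<close> is the \<open>i\<close>-th entry.\<close>

definition limit_moment :: "real^'m^'m \<Rightarrow> ('m \<Rightarrow> nat) \<Rightarrow> real" where
  "limit_moment G \<gamma> =
     (let g = (\<Sum>k\<in>UNIV. \<gamma> k) in
      1 / real g *
      (\<Sum>\<sigma>\<in>#arrangements \<gamma>.
         stationary G $ (\<sigma> ! 0) *
         (\<Prod>i=1..g - 1. resolvent G (real i) $ (\<sigma> ! (i - 1)) $ (\<sigma> ! i))))"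

text \<open>Measures on the simplex are represented as Borel measures on the ambient space that are
  concentrated on the simplex.\<close>

definition has_limit_moments :: "real^'m^'m \<Rightarrow> (real^'m) measure \<Rightarrow> bool" where
  "has_limit_moments G \<mu> \<longleftrightarrow>
     prob_space \<mu> \<and> sets \<mu> = sets borel \<and> (AE x in \<mu>. x \<in> prob_simplex) \<and>
     (\<forall>i. (\<integral>x. x $ i \<partial>\<mu>) = stationary G $ i) \<and>
     (\<forall>\<gamma>. (\<Sum>k\<in>UNIV. \<gamma> k) \<ge> 2 \<longrightarrow>
        (\<integral>x. (\<Prod>k\<in>UNIV. x $ k ^ \<gamma> k) \<partial>\<mu>) = limit_moment G \<gamma>)"

text \<open>The library's \<open>weak_conv_m\<close> covers only measures on the real line.\<close>

definition converges_in_distribution ::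
    "(nat \<Rightarrow> 'a::topological_space measure) \<Rightarrow> 'a measure \<Rightarrow> bool" where
  "converges_in_distribution M \<mu> \<longleftrightarrow>
     (\<forall>f::'a \<Rightarrow> real. continuous_on UNIV f \<and> bounded (range f) \<longrightarrow>
        (\<lambda>n. \<integral>x. f x \<partial>M n) \<longlonglongrightarrow> (\<integral>x. f x \<partial>\<mu>))"

lemma transition_stochastic:
  fixes G :: "real^'m^'m"
  assumes G: "G \<in> generators" and z: "\<zeta> > 0"
  shows "0 \<le> transition G \<zeta> n $ i $ j" "(\<Sum>j\<in>UNIV. transition G \<zeta> n $ i $ j) = 1"
proof -
  have off: "0 < G $ i $ j" if "i \<noteq> j" for i j using G that by (auto simp: generators_def)
  have dg: "G $ i $ i = - (\<Sum>j\<in>UNIV - {i}. G $ i $ j)" for i using G by (auto simp: generators_def)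
  show "0 \<le> transition G \<zeta> n $ i $ j"
  proof (cases "n \<le> threshold G \<zeta>")
    case True then show ?thesis by (simp add: transition_def mat_def)
  next
    case n: False
    show ?thesis
    proof (cases "i = j")
      case False
      with off[OF this] show ?thesis by (simp add: transition_def n mat_def)
    next
      case True
      have "\<bar>G $ i $ i\<bar> powr (1 / \<zeta>) \<le> Max (range (\<lambda>i. \<bar>G $ i $ i\<bar> powr (1 / \<zeta>)))"
        by (rule Max_ge) auto
      also have "\<dots> \<le> real (threshold G \<zeta>)"
        unfolding threshold_def by linarith
      also have "\<dots> \<le> real n" using n by simp
      finally have "(\<bar>G $ i $ i\<bar> powr (1 / \<zeta>)) powr \<zeta> \<le> real n powr \<zeta>"
        using z by (intro powr_mono2) auto
      then have "\<bar>G $ i $ i\<bar> \<le> real n powr \<zeta>" using z by (simp add: powr_powr)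
      moreover have "n > 0" using n by auto
      ultimately have "- G $ i $ i / real n powr \<zeta> \<le> 1" by (simp add: field_simps)
      then show ?thesis by (simp add: transition_def n mat_def True)
    qed
  qed
  have "(\<Sum>j\<in>UNIV. G $ i $ j) = G $ i $ i + (\<Sum>j\<in>UNIV - {i}. G $ i $ j)"
    by (rule sum.remove) auto
  then have s: "(\<Sum>j\<in>UNIV. G $ i $ j) = 0" using dg[of i] by simp
  have m: "(\<Sum>j\<in>UNIV. (mat 1 :: real^'m^'m) $ i $ j) = 1" by (simp add: mat_def)
  show "(\<Sum>j\<in>UNIV. transition G \<zeta> n $ i $ j) = 1"
    by (simp add: transition_def m s sum.distrib sum_divide_distrib[symmetric])
qed

lemma cylinder_in_sets [measurable]:
  fixes x :: "nat \<Rightarrow> 'm::finite"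
  shows "{\<omega>. \<forall>k<n. \<omega> k = x k} \<in> sets (path_space :: (nat \<Rightarrow> 'm) measure)"
proof -
  have "{\<omega> \<in> space path_space. \<forall>k<n. \<omega> k = x k} \<in> sets (path_space :: (nat \<Rightarrow> 'm) measure)"
    by measurable
  then show ?thesis by (simp add: space_PiM)
qed

lemma prob_eqI_cylinders:
  fixes M N :: "(nat \<Rightarrow> 'm::finite) measure"
  assumes "prob_space M" "prob_space N" and s: "sets M = sets path_space" "sets N = sets path_space"
    and eq: "\<And>n x. measure M {\<omega>. \<forall>k<n. \<omega> k = x k} = measure N {\<omega>. \<forall>k<n. \<omega> k = x k}"
  shows "M = N"
proof (rule measure_eqI_PiM_infinite[OF s])
  interpret M: prob_space M by fact
  interpret N: prob_space N by fact
  show "finite_measure M" by unfold_locales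
  fix A :: "nat \<Rightarrow> 'm set" and J :: "nat set" assume J: "finite J"
  obtain n where n: "J \<subseteq> {..<n}"
    using J finite_nat_iff_bounded by blast
  define B where "B = {y \<in> PiE {..<n} (\<lambda>_. UNIV). \<forall>k\<in>J. y k \<in> A k}"
  have finB: "finite B" unfolding B_def
    by (rule finite_subset[OF _ finite_PiE[of "{..<n}" "\<lambda>_. UNIV :: 'm set"]]) auto
  have E: "prod_emb UNIV (\<lambda>_. count_space UNIV) J (Pi\<^sub>E J A) = (\<Union>y\<in>B. {\<omega>. \<forall>k<n. \<omega> k = y k})"
    (is "?E = _")
  proof
    show "?E \<subseteq> (\<Union>y\<in>B. {\<omega>. \<forall>k<n. \<omega> k = y k})"
    proof
      fix \<omega> assume "\<omega> \<in> ?E"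
      then have "\<And>k. k \<in> J \<Longrightarrow> \<omega> k \<in> A k" by (auto simp: prod_emb_def PiE_iff)
      then have "restrict \<omega> {..<n} \<in> B" using n by (auto simp: B_def)
      then show "\<omega> \<in> (\<Union>y\<in>B. {\<omega>. \<forall>k<n. \<omega> k = y k})" by (rule UN_I) auto
    qed
    show "(\<Union>y\<in>B. {\<omega>. \<forall>k<n. \<omega> k = y k}) \<subseteq> ?E"
      using n by (fastforce simp: B_def prod_emb_def PiE_iff)
  qed
  have disj: "disjoint_family_on (\<lambda>y. {\<omega>. \<forall>k<n. \<omega> k = y k}) B"
    unfolding disjoint_family_on_def
  proof safe
    fix y z \<omega> assume yz: "y \<in> B" "z \<in> B" "y \<noteq> z" and *: "\<forall>k<n. \<omega> k = y k" "\<forall>k<n. \<omega> k = z k"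
    have "y = z"
      by (rule PiE_ext[of y "{..<n}" "\<lambda>_. UNIV" z]) (use yz * in \<open>auto simp: B_def\<close>)
    with yz show "\<omega> \<in> {}" by simp
  qed
  have "measure M ?E = (\<Sum>y\<in>B. measure M {\<omega>. \<forall>k<n. \<omega> k = y k})"
    unfolding E by (rule M.finite_measure_finite_Union[OF finB _ disj]) (auto simp: s)
  moreover have "measure N ?E = (\<Sum>y\<in>B. measure N {\<omega>. \<forall>k<n. \<omega> k = y k})"
    unfolding E by (rule N.finite_measure_finite_Union[OF finB _ disj]) (auto simp: s)
  ultimately show "emeasure M ?E = emeasure N ?E"
    by (simp add: M.emeasure_eq_measure N.emeasure_eq_measure eq)
qed

lemma is_chain_law_iff:
  fixes G :: "real^'m^'m"
  shows "is_chain_law G \<zeta> \<pi> M \<longleftrightarrow>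
     prob_space M \<and> sets M = sets path_space \<and>
     (\<forall>n x. measure M {\<omega>. \<forall>k\<le>n. \<omega> k = x k}
        = pmf \<pi> (x 0) * (\<Prod>k<n. transition G \<zeta> (Suc k) $ x k $ x (Suc k)))"
proof (cases "prob_space M \<and> sets M = sets path_space")
  case True
  then interpret M: prob_space M by simp
  have s: "sets M = sets path_space" using True by simp
  then have sp: "space M = UNIV" using sets_eq_imp_space_eq[OF s] by (simp add: space_PiM)
  have c: "{\<omega>. \<forall>k\<le>n. \<omega> k = x k} \<in> sets M" for n x
    using cylinder_in_sets[of "Suc n" x] by (simp add: s less_Suc_eq_le)
  let ?m = "\<lambda>n x. measure M {\<omega>. \<forall>k\<le>n. \<omega> k = x k}"
  have Suc_ev: "{\<omega>. \<omega> (Suc n) = j \<and> (\<forall>k\<le>n. \<omega> k = x k)} = {\<omega>. \<forall>k\<le>Suc n. \<omega> k = (x(Suc n := j)) k}" for n x j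
    by (auto simp: le_Suc_eq)
  have cp: "\<P>(\<omega> in M. \<omega> (Suc n) = j \<bar> \<forall>k\<le>n. \<omega> k = x k) = ?m (Suc n) (x(Suc n := j)) / ?m n x" for n x j
    by (simp add: cond_prob_def sp Suc_ev)
  have le: "?m (Suc n) x \<le> ?m n x" for n x
    by (rule M.finite_measure_mono) (auto simp: c)
  let ?p = "\<lambda>n x. pmf \<pi> (x 0) * (\<Prod>k<n. transition G \<zeta> (Suc k) $ x k $ x (Suc k))"
  have "(\<forall>i. \<P>(\<omega> in M. \<omega> 0 = i) = pmf \<pi> i) \<and>
     (\<forall>n x j. \<P>(\<omega> in M. \<forall>k\<le>n. \<omega> k = x k) > 0 \<longrightarrow>
        \<P>(\<omega> in M. \<omega> (Suc n) = j \<bar> \<forall>k\<le>n. \<omega> k = x k) = transition G \<zeta> (Suc n) $ x n $ j)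
    \<longleftrightarrow> (\<forall>n x. ?m n x = ?p n x)" (is "?I \<and> ?T \<longleftrightarrow> ?R")
  proof
    assume A: "?I \<and> ?T"
    have "?m n x = ?p n x" for n x
    proof (induction n)
      case 0
      show ?case using A by (simp add: sp)
    next
      case (Suc n)
      show ?case
      proof (cases "?m n x > 0")
        case True
        then have "\<P>(\<omega> in M. \<forall>k\<le>n. \<omega> k = x k) > 0" by (simp add: sp)
        then have "\<P>(\<omega> in M. \<omega> (Suc n) = x (Suc n) \<bar> \<forall>k\<le>n. \<omega> k = x k)
            = transition G \<zeta> (Suc n) $ x n $ x (Suc n)"
          using A by blast
        then have "?m (Suc n) x / ?m n x = transition G \<zeta> (Suc n) $ x n $ x (Suc n)"
          unfolding cp by simp
        then have "?m (Suc n) x = ?m n x * transition G \<zeta> (Suc n) $ x n $ x (Suc n)"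
          using True by (simp add: field_simps)
        then show ?thesis using Suc by simp
      next
        case False
        then have z: "?m n x = 0" by (simp add: order.antisym not_less)
        then have "?m (Suc n) x = 0" using le[of n x] by (simp add: order.antisym)
        moreover have "?p (Suc n) x = ?p n x * transition G \<zeta> (Suc n) $ x n $ x (Suc n)" by simp
        ultimately show ?thesis using z Suc.IH by (metis mult_zero_left)
      qed
    qed
    then show ?R by blast
  next
    assume R: ?R
    have ?I
    proof
      fix i show "\<P>(\<omega> in M. \<omega> 0 = i) = pmf \<pi> i"
        using R[rule_format, of 0 "\<lambda>_. i"] by (simp add: sp)
    qed
    moreover have ?T
    proof (intro allI impI)
      fix n x j assume "\<P>(\<omega> in M. \<forall>k\<le>n. \<omega> k = x k) > 0"
      then have pos: "?m n x > 0" by (simp add: sp)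
      have "(\<Prod>k<n. transition G \<zeta> (Suc k) $ (x(Suc n := j)) k $ (x(Suc n := j)) (Suc k))
          = (\<Prod>k<n. transition G \<zeta> (Suc k) $ x k $ x (Suc k))"
        by (rule prod.cong) auto
      then have "?p (Suc n) (x(Suc n := j)) = ?p n x * transition G \<zeta> (Suc n) $ x n $ j"
        by simp
      then have "?m (Suc n) (x(Suc n := j)) = ?m n x * transition G \<zeta> (Suc n) $ x n $ j"
        using R by metis
      then show "\<P>(\<omega> in M. \<omega> (Suc n) = j \<bar> \<forall>k\<le>n. \<omega> k = x k) = transition G \<zeta> (Suc n) $ x n $ j"
        unfolding cp using pos by simp
    qed
    ultimately show "?I \<and> ?T" by blast
  qed
  then show ?thesis unfolding is_chain_law_def by blast
qed (auto simp: is_chain_law_def)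

lemma ex_chain_law:
  fixes G :: "real^'m^'m"
  assumes G: "G \<in> generators" and z: "\<zeta> > 0"
  shows "\<exists>M. is_chain_law G \<zeta> \<pi> M"
proof -
  let ?S = "\<lambda>_::nat. count_space (UNIV :: 'm set)"
  define row where "row n i = embed_pmf (\<lambda>j. transition G \<zeta> n $ i $ j)" for n i
  have pmf_row: "pmf (row n i) j = transition G \<zeta> n $ i $ j" for n i j
    unfolding row_def using transition_stochastic[OF G z]
    by (subst pmf_embed_pmf) (auto simp: nn_integral_count_space_finite sum_nonneg)
  define K where "K n \<omega> = measure_pmf (case n of 0 \<Rightarrow> \<pi> | Suc k \<Rightarrow> row n (\<omega> k))" for n and \<omega> :: "nat \<Rightarrow> 'm"
  have K1: "K n \<in> measurable (PiM {0..<n} ?S) (subprob_algebra (?S n))" for n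
  proof (cases n)
    case 0
    then show ?thesis
      by (auto simp: K_def[abs_def] space_subprob_algebra intro!: measurable_const prob_space_imp_subprob_space prob_space_measure_pmf)
  next
    case (Suc k)
    have 1: "(\<lambda>\<omega>. \<omega> k) \<in> measurable (PiM {0..<n} ?S) (count_space UNIV)"
      using Suc by (intro measurable_component_singleton) auto
    have 2: "(\<lambda>i. measure_pmf (row n i)) \<in> measurable (count_space UNIV) (subprob_algebra (?S n))"
      by (auto simp: space_subprob_algebra intro!: prob_space_imp_subprob_space prob_space_measure_pmf)
    show ?thesis
      using measurable_compose[OF 1 2] by (simp add: K_def[abs_def] Suc)
  qed
  have K2: "prob_space (K n x)" for n x unfolding K_def by (rule prob_space_measure_pmf)
  interpret IT: Ionescu_Tulcea K ?S
    by (rule Ionescu_Tulcea.intro[OF K1 K2])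
  let ?M = "IT.PF.lim"
  have sets_M: "sets ?M = sets path_space" by simp
  have sing: "{restrict x {0..<n}} \<in> sets (PiM {0..<n} ?S)" for x :: "nat \<Rightarrow> 'm" and n
  proof -
    have "Pi\<^sub>E {0..<n} (\<lambda>k. {x k}) \<in> sets (PiM {0..<n} ?S)" by (intro sets_PiM_I_finite) auto
    also have "Pi\<^sub>E {0..<n} (\<lambda>k. {x k}) = Pi\<^sub>E {0..<n} (\<lambda>k. {restrict x {0..<n} k})"
      by (rule PiE_cong) simp
    also have "\<dots> = {restrict x {0..<n}}" 
      by (rule PiE_singleton) (rule restrict_extensional)
    finally show ?thesis .
  qed
  have in_sp: "restrict x {0..<n} \<in> space (PiM {0..<n} ?S)" for x n by (simp add: space_PiM)
  have u: "(\<lambda>_. undefined) \<in> space (PiM {0..<0} ?S)" by (simp add: space_PiM)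
  have C: "emeasure (IT.C 0 n (\<lambda>_. undefined)) {restrict x {0..<n}} = (\<Prod>k<n. ennreal (pmf (case k of 0 \<Rightarrow> \<pi> | Suc l \<Rightarrow> row k (x l)) (x k)))" for n x
  proof (induction n)
    case 0
    have "restrict x {0..<0} = (\<lambda>_. undefined)" by auto
    then show ?case using sing[of x 0] by (simp del: restrict_apply)
  next
    case (Suc n)
    let ?X = "{restrict x {0..<Suc n}}" and ?c = "pmf (case n of 0 \<Rightarrow> \<pi> | Suc l \<Rightarrow> row n (x l)) (x n)"
    have e: "emeasure (IT.eP n \<omega>) ?X = ennreal ?c * indicator {restrict x {0..<n}} \<omega>" if \<omega>: "\<omega> \<in> space (PiM {0..<n} ?S)" for \<omega>
    proof -
      have upd: "fun_upd \<omega> n -` ?X = (if \<omega> = restrict x {0..<n} then {x n} else {})"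
      proof -
        have "fun_upd \<omega> n a = restrict x {0..<Suc n} \<longleftrightarrow> \<omega> = restrict x {0..<n} \<and> a = x n" for a
        proof
          assume h: "fun_upd \<omega> n a = restrict x {0..<Suc n}"
          have "\<omega> k = restrict x {0..<n} k" for k
            using fun_cong[OF h, of k] \<omega> by (cases "k < n"; cases "k = n") (auto simp: space_PiM PiE_iff extensional_def)
          moreover have "a = x n" using fun_cong[OF h, of n] by simp
          ultimately show "\<omega> = restrict x {0..<n} \<and> a = x n" by auto
        qed (auto simp: fun_eq_iff)
        then show ?thesis by (auto simp: vimage_def)
      qed
      have "emeasure (IT.eP n \<omega>) ?X = emeasure (K n \<omega>) (fun_upd \<omega> n -` ?X \<inter> space (?S n))"
        by (rule IT.emeasure_eP[OF \<omega> sing])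
      also have "\<dots> = ennreal ?c * indicator {restrict x {0..<n}} \<omega>"
        unfolding upd by (cases n) (auto simp: K_def emeasure_pmf_single)
      finally show ?thesis .
    qed
    have ne: "space (IT.C 0 n (\<lambda>_. undefined)) \<noteq> {}"
      using IT.space_C[OF u, of n] in_sp by (auto simp: simp del: restrict_apply)
    have "emeasure (IT.C 0 (Suc n) (\<lambda>_. undefined)) ?X
       = (\<integral>\<^sup>+\<omega>. emeasure (IT.eP n \<omega>) ?X \<partial>IT.C 0 n (\<lambda>_. undefined))"
      using IT.measurable_eP[of n] sing[of x "Suc n"] ne
      by (simp, subst emeasure_bind[where N="PiM {0..<Suc n} ?S"])
         (auto simp: measurable_cong_sets[OF IT.sets_C[OF u, of n] refl] simp del: restrict_apply)
    also have "\<dots> = (\<integral>\<^sup>+\<omega>. ennreal ?c * indicator {restrict x {0..<n}} \<omega> \<partial>IT.C 0 n (\<lambda>_. undefined))"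
      by (intro nn_integral_cong e) (simp add: IT.space_C[OF u])
    also have "\<dots> = ennreal ?c * emeasure (IT.C 0 n (\<lambda>_. undefined)) {restrict x {0..<n}}"
      using sing[of x n] IT.sets_C[OF u, of n] by (intro nn_integral_cmult_indicator) (simp del: restrict_apply)
    finally show ?case unfolding Suc.IH prod.lessThan_Suc by (simp only: mult.commute)
  qed
  have cyl: "prod_emb UNIV ?S {0..<n} {restrict x {0..<n}} = {\<omega>. \<forall>k<n. \<omega> k = x k}" for x :: "nat \<Rightarrow> 'm" and n
    by (auto simp: prod_emb_def fun_eq_iff restrict_def) metis
  have em: "emeasure ?M {\<omega>. \<forall>k<n. \<omega> k = x k} = (\<Prod>k<n. ennreal (pmf (case k of 0 \<Rightarrow> \<pi> | Suc l \<Rightarrow> row k (x l)) (x k)))" for n x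
  proof -
    have "prod_emb {0..<n} ?S {0..<n} {restrict x {0..<n}} = {restrict x {0..<n}}"
      by (rule prod_emb_id) (auto simp: PiE_iff)
    then show ?thesis
      using IT.lim[OF finite_atLeastLessThan sing[of x n]] IT.emeasure_CI[OF order_refl sing[of x n]]
      by (simp only: cyl C)
  qed
  have ps: "prob_space ?M"
  proof (rule prob_spaceI)
    show "emeasure ?M (space ?M) = 1" using em[of 0 undefined] by (simp add: space_PiM)
  qed
  have "measure ?M {\<omega>. \<forall>k\<le>n. \<omega> k = x k}
        = pmf \<pi> (x 0) * (\<Prod>k<n. transition G \<zeta> (Suc k) $ x k $ x (Suc k))" for n x
  proof -
    have "emeasure ?M {\<omega>. \<forall>k\<le>n. \<omega> k = x k} = (\<Prod>k<Suc n. ennreal (pmf (case k of 0 \<Rightarrow> \<pi> | Suc l \<Rightarrow> row k (x l)) (x k)))"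
      using em[of "Suc n" x] by (simp add: less_Suc_eq_le)
    also have "\<dots> = ennreal (\<Prod>k<Suc n. pmf (case k of 0 \<Rightarrow> \<pi> | Suc l \<Rightarrow> row k (x l)) (x k))"
      by (rule prod_ennreal) simp
    finally have "measure ?M {\<omega>. \<forall>k\<le>n. \<omega> k = x k} = (\<Prod>k<Suc n. pmf (case k of 0 \<Rightarrow> \<pi> | Suc l \<Rightarrow> row k (x l)) (x k))"
      unfolding measure_def by (simp add: prod_nonneg del: prod.lessThan_Suc)
    also have "\<dots> = pmf \<pi> (x 0) * (\<Prod>k<n. transition G \<zeta> (Suc k) $ x k $ x (Suc k))"
      by (subst prod.lessThan_Suc_shift) (simp add: pmf_row)
    finally show ?thesis .
  qed
  then have "is_chain_law G \<zeta> \<pi> ?M" unfolding is_chain_law_iff using ps sets_M by blast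
  then show ?thesis ..
qed

lemma ex1_chain_law:
  fixes G :: "real^'m^'m"
  assumes "G \<in> generators" and "\<zeta> > 0"
  shows "\<exists>!M. is_chain_law G \<zeta> \<pi> M"
proof (rule ex_ex1I)
  show "\<exists>M. is_chain_law G \<zeta> \<pi> M" by (rule ex_chain_law[OF assms])
  fix M N assume M: "is_chain_law G \<zeta> \<pi> M" and N: "is_chain_law G \<zeta> \<pi> N"
  interpret M: prob_space M using M by (simp add: is_chain_law_def)
  interpret N: prob_space N using N by (simp add: is_chain_law_def)
  have s: "sets M = sets path_space" "sets N = sets path_space" using M N by (auto simp: is_chain_law_def)
  show "M = N"
  proof (rule prob_eqI_cylinders[OF M.prob_space_axioms N.prob_space_axioms s])
    fix n and x :: "nat \<Rightarrow> 'm"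
    show "measure M {\<omega>. \<forall>k<n. \<omega> k = x k} = measure N {\<omega>. \<forall>k<n. \<omega> k = x k}"
    proof (cases n)
      case 0
      have "space M = UNIV" "space N = UNIV"
        using s[THEN sets_eq_imp_space_eq] by (auto simp: space_PiM)
      then show ?thesis using M.prob_space N.prob_space 0 by simp
    next
      case (Suc k)
      then show ?thesis using M N by (simp add: is_chain_law_iff less_Suc_eq_le)
    qed
  qed
qed

lemma is_chain_law_chain_law:
  fixes G :: "real^'m^'m"
  assumes "G \<in> generators" and "\<zeta> > 0"
  shows "is_chain_law G \<zeta> \<pi> (chain_law G \<zeta> \<pi>)"
  unfolding chain_law_def by (rule theI'[OF ex1_chain_law[OF assms]])

lemma invertible_resolvent:
  fixes G :: "real^'m^'m"
  assumes G: "G \<in> generators" and x: "x > 0"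
  shows "invertible (mat x - G)"
proof -
  have off: "0 < G $ i $ j" if "i \<noteq> j" for i j using G that by (auto simp: generators_def)
  have dg: "G $ i $ i = - (\<Sum>j\<in>UNIV - {i}. G $ i $ j)" for i using G by (auto simp: generators_def)
  have le: "v $ i \<le> 0" if v: "(mat x - G) *v v = 0" for v i
  proof -
    have "Max (range (($) v)) \<in> range (($) v)" by (rule Max_in) auto
    then obtain k where k': "Max (range (($) v)) = v $ k" by (rule imageE)
    have k: "v $ j \<le> v $ k" for j unfolding k'[symmetric] by (rule Max_ge) auto
    have "0 = ((mat x - G) *v v) $ k" using v by simp
    also have "\<dots> = x * v $ k - (\<Sum>j\<in>UNIV. G $ k $ j * v $ j)"
      by (simp add: matrix_vector_mult_def mat_def left_diff_distrib sum_subtractf if_distrib[of "\<lambda>a. a * _"] cong: if_cong)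
    also have "(\<Sum>j\<in>UNIV. G $ k $ j * v $ j) = G $ k $ k * v $ k + (\<Sum>j\<in>UNIV-{k}. G $ k $ j * v $ j)"
      by (rule sum.remove) auto
    also have "\<dots> = (\<Sum>j\<in>UNIV-{k}. G $ k $ j * (v $ j - v $ k))"
      by (simp add: dg[of k] right_diff_distrib sum_subtractf sum_distrib_right)
    finally have "x * v $ k = (\<Sum>j\<in>UNIV-{k}. G $ k $ j * (v $ j - v $ k))" by simp
    also have "\<dots> \<le> 0" using off k by (intro sum_nonpos mult_nonneg_nonpos) (auto simp: less_imp_le)
    finally have "v $ k \<le> 0" using x by (simp add: mult_le_0_iff)
    then show ?thesis using k[of i] by simp
  qed
  have "v = 0" if v: "(mat x - G) *v v = 0" for v
  proof -
    have "(mat x - G) *v (- v) = 0"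
      using v linear_neg[OF matrix_vector_mul_linear, of "mat x - G" v] by simp
    from le[OF v] le[OF this] have "v $ i = 0" for i by (metis order_antisym neg_le_0_iff_le vector_uminus_component)
    then show ?thesis by (simp add: vec_eq_iff)
  qed
  then show ?thesis by (metis matrix_left_invertible_ker invertible_left_inverse)
qed

lemma count_arrangements:
  fixes \<gamma> :: "'m::finite \<Rightarrow> nat"
  shows "count (arrangements \<gamma>) \<sigma> =
     (if \<forall>k. count (mset \<sigma>) k = \<gamma> k then \<Prod>k\<in>UNIV. fact (\<gamma> k) else 0)"
proof -
  have key: "card {l \<in> permutations_of_set A. map fst l = s} =
     (if \<forall>k. count (mset s) k = card {a. (k, a) \<in> A} then \<Prod>k\<in>UNIV. fact (card {a. (k, a) \<in> A}) else 0)"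
    if "finite A" for A :: "('m \<times> nat) set" and s
    using that
  proof (induction s arbitrary: A)
    case Nil
    have "{l \<in> permutations_of_set A. map fst l = []} = (if A = {} then {[]} else {})"
      by (auto simp: permutations_of_set_def)
    moreover have "(\<forall>k. 0 = card {a. (k, a) \<in> A}) \<longleftrightarrow> A = {}"
    proof -
      have "finite {a. (k,a) \<in> A}" for k
        using finite_vimageI[OF \<open>finite A\<close>, of "Pair k"] by (simp add: vimage_def inj_on_def)
      then show ?thesis by auto
    qed
    ultimately show ?case by auto
  next
    case (Cons c s)
    let ?f = "\<lambda>A k. {a. (k, a) \<in> A}"
    have fin: "finite (?f A k)" for k
      using finite_vimageI[OF \<open>finite A\<close>, of "Pair k"] by (simp add: vimage_def inj_on_def)
    have eq: "{l \<in> permutations_of_set A. map fst l = c # s} =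
       (\<Union>a\<in>?f A c. (#) (c, a) ` {l \<in> permutations_of_set (A - {(c, a)}). map fst l = s})"
      (is "?L = ?R")
    proof
      show "?L \<subseteq> ?R"
      proof
        fix l assume "l \<in> ?L"
        then obtain a l' where "l = (c,a) # l'" "map fst l' = s" "set l = A" "distinct l"
          by (auto simp: permutations_of_set_def map_eq_Cons_conv)
        then have "a \<in> ?f A c" "l' \<in> permutations_of_set (A - {(c, a)})"
          by (auto simp: permutations_of_set_def)
        with \<open>l = _\<close> \<open>map fst l' = s\<close> show "l \<in> ?R" by blast
      qed
      show "?R \<subseteq> ?L"
      proof
        fix l assume "l \<in> ?R"
        then obtain a l' where *: "(c, a) \<in> A" "l = (c, a) # l'" "map fst l' = s"
            "set l' = A - {(c, a)}" "distinct l'"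
          unfolding permutations_of_set_def by blast
        then show "l \<in> ?L" by (simp add: permutations_of_set_def insert_absorb)
      qed
    qed
    have sub: "?f (A - {(c, a)}) k = (if k = c then ?f A c - {a} else ?f A k)" for a k by auto
    let ?P = "\<forall>k. count (mset (c # s)) k = card (?f A k)"
    have "card ?L = (\<Sum>a\<in>?f A c. card {l \<in> permutations_of_set (A - {(c, a)}). map fst l = s})"
      unfolding eq using fin Cons.prems
      by (subst card_UN_disjoint) (auto simp: card_image inj_on_def)
    also have "\<dots> = (\<Sum>a\<in>?f A c. if ?P then (\<Prod>k\<in>UNIV. fact (card (?f A k))) div card (?f A c) else 0)"
    proof (rule sum.cong[OF refl])
      fix a assume a: "a \<in> ?f A c"
      then have pos: "card (?f A c) > 0" using fin by (auto simp: card_gt_0_iff)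
      have cd: "card (?f (A - {(c, a)}) k) = (if k = c then card (?f A c) - 1 else card (?f A k))" for k
        unfolding sub using a fin by simp
      have P: "(\<forall>k. count (mset s) k = card (?f (A - {(c, a)}) k)) \<longleftrightarrow> ?P"
        unfolding cd using pos by (auto split: if_splits) 
      have "(\<Prod>k\<in>UNIV. fact (card (?f A k)) :: nat) = fact (card (?f A c)) * (\<Prod>k\<in>UNIV-{c}. fact (card (?f A k)))"
        by (rule prod.remove) auto
      also have "fact (card (?f A c)) = card (?f A c) * (fact (card (?f A c) - 1) :: nat)"
        using pos by (simp add: fact_reduce)
      finally have "(\<Prod>k\<in>UNIV. fact (card (?f A k)) :: nat) div card (?f A c) = fact (card (?f A c) - 1) * (\<Prod>k\<in>UNIV-{c}. fact (card (?f A k)))"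
        using pos by (simp add: mult.assoc)
      also have "\<dots> = (\<Prod>k\<in>UNIV. fact (card (?f (A - {(c, a)}) k)))"
        unfolding cd by (subst prod.remove[of UNIV c]) auto
      finally have Q: "(\<Prod>k\<in>UNIV. fact (card (?f (A - {(c, a)}) k)) :: nat) = (\<Prod>k\<in>UNIV. fact (card (?f A k))) div card (?f A c)" ..
      have "card {l \<in> permutations_of_set (A - {(c, a)}). map fst l = s} =
        (if \<forall>k. count (mset s) k = card (?f (A - {(c, a)}) k) then \<Prod>k\<in>UNIV. fact (card (?f (A - {(c, a)}) k)) else 0)"
        using Cons.prems by (intro Cons.IH) auto
      then show "card {l \<in> permutations_of_set (A - {(c, a)}). map fst l = s} =
         (if ?P then (\<Prod>k\<in>UNIV. fact (card (?f A k))) div card (?f A c) else 0)"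
        unfolding P Q .
    qed
    also have "\<dots> = (if ?P then \<Prod>k\<in>UNIV. fact (card (?f A k)) else 0)"
    proof (cases ?P)
      case True
      then have "card (?f A c) > 0" by (metis count_mset_0_iff list.set_intros(1) gr0I)
      moreover have "card (?f A c) dvd (\<Prod>k\<in>UNIV. fact (card (?f A k)))"
        using calculation by (intro dvd_trans[OF dvd_fact[of "card (?f A c)" "card (?f A c)"]] dvd_prodI) auto
      ultimately show ?thesis using True by simp
    next
      case False
      show ?thesis unfolding if_not_P[OF False] by simp
    qed
    finally show ?case .
  qed
  let ?A = "SIGMA k:UNIV. {..<\<gamma> k}"
  have "count (arrangements \<gamma>) \<sigma> = card {l \<in> permutations_of_set ?A. map fst l = \<sigma>}"
    unfolding arrangements_def
    by (subst count_image_mset) (auto simp: vimage_def Int_def conj_commute intro!: arg_cong[where f=card])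
  also have "{a. (k, a) \<in> ?A} = {..<\<gamma> k}" for k by auto
  then have "card {l \<in> permutations_of_set ?A. map fst l = \<sigma>} = (if \<forall>k. count (mset \<sigma>) k = \<gamma> k then \<Prod>k\<in>UNIV. fact (\<gamma> k) else 0)"
    by (subst key) auto
  finally show ?thesis .
qed

end

theory Submission
  imports Defs
begin

text \<open>For a multiset \<open>A\<close> of \<open>g\<close> states let \<open>B\<^sub>A(n)\<close> be the vector of expectations of the product of the
  binomial coefficients of the visit counts at time \<open>n\<close>, split according to the state \<open>X\<^sub>n\<close>. By Pascal's rule
  the rescaled vectors \<open>f\<^sub>A(n) = B\<^sub>A(n) / n\<^sup>g\<close> satisfy, up to lower order terms,
  \<open>f\<^sub>A(n+1) = f\<^sub>A(n) + (f\<^sub>A(n) (G - g I) + c\<^sub>A(n)) / n\<close>, where \<open>c\<^sub>A(n)\<close> is built from the vectors of \<open>A\<close> with one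
  element removed. Hence \<open>f\<^sub>A\<close> converges to \<open>c\<^sub>A (g I - G)\<^sup>-\<^sup>1\<close>, and unwinding this recursion down to the law of
  \<open>X\<^sub>n\<close>, which tends to the stationary vector by Doeblin's contraction, gives the sum over words.
  A limit measure exists by compactness: a space-filling curve transfers Helly's selection theorem
  from the line to compact sets. Weierstrass approximation shows that the moments determine it and
  that convergence of moments implies convergence in distribution.\<close>

section \<open>Selection of convergent subsequences on compact sets\<close>

text \<open>Splitting by the current state is what closes the recursion: the next letter depends on
  the past only through \<open>X\<^sub>n\<close>. For \<open>\<zeta> = 1\<close> the step size of
  the chain and the relative change of \<open>n ^ g\<close> are both of order \<open>1 / n\<close>;
  therefore \<open>G\<close> and \<open>g I\<close> meet in the limit equation and its solution is a
  resolvent. No spectral information enters. For \<open>g \<ge> 1\<close> the factor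
  \<open>(n / (n + 1)) ^ g\<close> alone damps the error, since stochastic matrices do not increase
  the l1 norm of row vectors. For \<open>g = 0\<close> this damping is absent and has to come from
  mixing: transition probabilities of order \<open>1 / n\<close> yield contraction rates whose sum
  diverges, just enough to forget the initial law.\<close>

lemma binary_expansion:
  fixes x :: real
  assumes "0 \<le> x" "x \<le> 1"
  shows "\<exists>d :: nat \<Rightarrow> real. (\<forall>n. d n \<in> {0, 1}) \<and> (\<lambda>n. d n / 2 ^ Suc n) sums x"
proof -
  \<comment> \<open>\<open>r n\<close> is the remainder after \<open>n\<close> greedy digits,
    magnified by \<open>2 ^ n\<close>; it stays in the unit interval, and \<open>x = 1\<close> gets
    the digits 1, 1, ...\<close>
  define r where "r = rec_nat x (\<lambda>_ y. 2 * y - (if y \<ge> 1/2 then 1 else 0))"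
  define d where "d n = (if r n \<ge> 1/2 then 1 else 0 :: real)" for n
  have r0: "r 0 = x" and rS: "r (Suc n) = 2 * r n - d n" for n
    by (auto simp: r_def d_def)
  have r: "0 \<le> r n \<and> r n \<le> 1" for n
    by (induction n) (use assms in \<open>auto simp: r0 rS d_def\<close>)
  have part: "(\<Sum>k<n. d k / 2 ^ Suc k) = x - r n / 2 ^ n" for n
    by (induction n) (auto simp: r0 rS field_simps)
  have "(\<lambda>n. r n / 2 ^ n) \<longlonglongrightarrow> 0"
  proof (rule tendsto_sandwich[of "\<lambda>_. 0" _ _ "\<lambda>n. (1/2) ^ n"])
    show "\<forall>\<^sub>F n in sequentially. 0 \<le> r n / 2 ^ n" using r by simp
    show "\<forall>\<^sub>F n in sequentially. r n / 2 ^ n \<le> (1/2) ^ n" using r by (simp add: power_divide divide_right_mono)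
    show "(\<lambda>n. (1/2 :: real) ^ n) \<longlonglongrightarrow> 0" by (rule LIMSEQ_realpow_zero) auto
  qed simp
  then have "(\<lambda>n. x - r n / 2 ^ n) \<longlonglongrightarrow> x - 0" by (intro tendsto_intros)
  then have "(\<lambda>n. d n / 2 ^ Suc n) sums x" unfolding sums_def part by simp
  then show ?thesis by (intro exI[of _ d]) (auto simp: d_def)
qed

text \<open>A continuous function of period \<open>2\<close> that is \<open>0\<close> on \<open>[0, 1/3]\<close> and \<open>1\<close> on \<open>[2/3, 1]\<close>, hence
  reads off the leading digit of a ternary expansion with digits \<open>0\<close> and \<open>2\<close>.\<close>

definition schoenberg_wave :: "real \<Rightarrow> real" where
  "schoenberg_wave s = max 0 (min 1 (1/2 - cos (pi * s)))"

text \<open>The point of the Cantor set whose ternary digits are \<open>2 * a k\<close>.\<close>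

definition ternary :: "(nat \<Rightarrow> real) \<Rightarrow> real" where
  "ternary a = (\<Sum>k. 2 * a k / 3 ^ Suc k)"

lemma schoenberg_wave_bounds: "0 \<le> schoenberg_wave s" "schoenberg_wave s \<le> 1"
  by (auto simp: schoenberg_wave_def)

lemma continuous_on_schoenberg_wave: "continuous_on S schoenberg_wave"
  unfolding schoenberg_wave_def[abs_def] by (intro continuous_intros)

lemma ternary_sums: "(\<lambda>k. 2 / 3 ^ Suc k) sums (1 :: real)"
  using sums_mult[OF geometric_sums[of "1/3 :: real"], of "2/3"] by (simp add: power_divide)

lemma
  assumes a: "\<And>n. a n \<in> {0, 1 :: real}"
  shows summable_ternary: "summable (\<lambda>k. 2 * a k / 3 ^ Suc k)"
    and ternary_nonneg: "0 \<le> ternary a"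
    and ternary_le_1: "ternary a \<le> 1"
proof -
  have b: "0 \<le> a n" "a n \<le> 1" for n using a[of n] by auto
  show s: "summable (\<lambda>k. 2 * a k / 3 ^ Suc k)"
    by (rule summable_comparison_test'[OF sums_summable[OF ternary_sums], of 0])
       (use b in \<open>auto simp: divide_right_mono\<close>)
  show "0 \<le> ternary a" unfolding ternary_def
    by (rule suminf_nonneg[OF s]) (use b in auto)
  have "ternary a \<le> (\<Sum>k. 2 / 3 ^ Suc k)" unfolding ternary_def
    by (rule suminf_le[OF _ s sums_summable[OF ternary_sums]]) (use b in \<open>auto simp: divide_right_mono\<close>)
  then show "ternary a \<le> 1" using sums_unique[OF ternary_sums] by simp
qed

lemma ternary_shift:
  assumes "\<And>n. a n \<in> {0, 1 :: real}"
  shows "3 * ternary a = 2 * a 0 + ternary (\<lambda>n. a (Suc n))"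
proof -
  have "ternary a = (\<Sum>k. 2 * a (Suc k) / 3 ^ Suc (Suc k)) + 2 * a 0 / 3"
    unfolding ternary_def using suminf_split_head[OF summable_ternary[of a, OF assms]] by simp
  also have "(\<Sum>k. 2 * a (Suc k) / 3 ^ Suc (Suc k)) = (\<Sum>k. (1/3) * (2 * a (Suc k) / 3 ^ Suc k))"
    by (simp add: field_simps)
  also have "\<dots> = (1/3) * ternary (\<lambda>n. a (Suc n))"
    unfolding ternary_def by (rule suminf_mult) (rule summable_ternary, rule assms)
  finally show ?thesis by simp
qed

text \<open>A leading digit 0 or 2 puts the point into \<open>[0, 1/3]\<close> or
  \<open>[2/3, 1]\<close>. There the cosine is at least 1/2 or at most -1/2, and the clipping in the
  wave turns these inequalities into the exact values 0 and 1.\<close>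

lemma schoenberg_wave_leading_digit:
  assumes a: "\<And>n. a n \<in> {0, 1 :: real}"
  shows "schoenberg_wave (ternary a) = a 0"
proof -
  let ?t = "ternary a"
  have t: "0 \<le> ?t" "?t \<le> 1" using ternary_nonneg[OF a] ternary_le_1[OF a] by auto
  have s: "0 \<le> ternary (\<lambda>n. a (Suc n))" "ternary (\<lambda>n. a (Suc n)) \<le> 1"
    using ternary_nonneg[of "\<lambda>n. a (Suc n)"] ternary_le_1[of "\<lambda>n. a (Suc n)"] a by auto
  from a[of 0] consider "a 0 = 0" | "a 0 = 1" by auto
  then show ?thesis
  proof cases
    case 1
    then have "?t \<le> 1/3" using ternary_shift[of a, OF a] s by simp
    then have "cos (pi / 3) \<le> cos (pi * ?t)"
      using t by (intro cos_monotone_0_pi_le) auto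
    then show ?thesis using 1 by (simp add: cos_60 schoenberg_wave_def)
  next
    case 2
    then have "?t \<ge> 2/3" using ternary_shift[of a, OF a] s by simp
    then have "cos (pi * ?t) \<le> cos (2 * pi / 3)"
      using t by (intro cos_monotone_0_pi_le) (auto simp: mult.commute)
    then show ?thesis using 2 by (simp add: cos_120 schoenberg_wave_def)
  qed
qed

text \<open>Multiplication by \<open>3 ^ k\<close> brings digit \<open>k\<close> to the front. The
  digits moved before the point form an even integer, because all digits are even, and the wave has
  period 2.\<close>

lemma schoenberg_wave_digit:
  assumes a: "\<And>n. a n \<in> {0, 1 :: real}"
  shows "schoenberg_wave (3 ^ k * ternary a) = a k"
proof -
  have "\<exists>z :: int. 3 ^ k * ternary a = 2 * of_int z + ternary (\<lambda>n. a (n + k))"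
  proof (induction k)
    case 0 show ?case by (rule exI[of _ 0]) simp
  next
    case (Suc k)
    then obtain z :: int where z: "3 ^ k * ternary a = 2 * of_int z + ternary (\<lambda>n. a (n + k))" by blast
    have "3 ^ Suc k * ternary a = 2 * of_int (3 * z) + 3 * ternary (\<lambda>n. a (n + k))"
      using z by simp
    also have "3 * ternary (\<lambda>n. a (n + k)) = 2 * a k + ternary (\<lambda>n. a (n + Suc k))"
      using ternary_shift[of "\<lambda>n. a (n + k)"] a by simp
    also obtain w :: int where "a k = of_int w" using a[of k] by (metis empty_iff insertE of_int_0 of_int_1)
    finally show ?case by (intro exI[of _ "3 * z + w"]) simp
  qed
  then obtain z :: int where z: "3 ^ k * ternary a = 2 * of_int z + ternary (\<lambda>n. a (n + k))" by blast
  have "cos (pi * (2 * of_int z + s)) = cos (pi * s)" for s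
  proof -
    have "cos (pi * (2 * of_int z + s)) = cos (2 * pi * of_int z + pi * s)"
      by (simp add: algebra_simps)
    then show ?thesis using cos_int_2pin[of z] sin_int_2pin[of z] by (simp add: cos_add)
  qed
  then have "schoenberg_wave (3 ^ k * ternary a) = schoenberg_wave (ternary (\<lambda>n. a (n + k)))"
    unfolding z schoenberg_wave_def by simp
  then show ?thesis using schoenberg_wave_leading_digit[of "\<lambda>n. a (n + k)"] a by simp
qed

text \<open>One Cantor point stores the binary digits of all coordinates, with
  \<open>prod_encode\<close> fixing where digit \<open>n\<close> of coordinate \<open>i\<close>
  sits; coordinate \<open>i\<close> of the curve reads its digits back. The wave is continuous on
  the whole line, so uniform convergence of the series gives continuity everywhere.\<close>

lemma space_filling_curve:
  "\<exists>\<phi> :: real \<Rightarrow> real^'m. continuous_on UNIV \<phi> \<and> {x. \<forall>i. x $ i \<in> {0..1}} \<subseteq> \<phi> ` {0..1}"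
proof -
  obtain e :: "'m \<Rightarrow> nat" where e: "inj e"
    using finite_imp_inj_to_nat_seg[of "UNIV :: 'm set"] by auto
  define k where "k i n = prod_encode (n, e i)" for i :: 'm and n
  define c where "c i n t = schoenberg_wave (3 ^ k i n * t) / 2 ^ Suc n" for i n t
  define \<phi> where "\<phi> t = (\<chi> i. \<Sum>n. c i n t)" for t
  have c: "norm (c i n t) \<le> (1/2) ^ Suc n" for i n t
    using schoenberg_wave_bounds[of "3 ^ k i n * t"] by (simp add: c_def power_divide divide_right_mono)
  have "continuous_on UNIV (\<lambda>t. \<Sum>n. c i n t)" for i
  proof (rule uniform_limit_theorem[OF _ Weierstrass_m_test[of UNIV "c i"]])
    show "summable (\<lambda>n. (1/2 :: real) ^ Suc n)" by (subst summable_Suc_iff) (rule summable_geometric, simp)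
    show "\<forall>\<^sub>F n in sequentially. continuous_on UNIV (\<lambda>t. \<Sum>l<n. c i l t)"
      unfolding c_def
      by (intro always_eventually allI continuous_intros
          continuous_on_compose2[OF continuous_on_schoenberg_wave[of UNIV]]) auto
  qed (use c in auto)
  then have "continuous_on UNIV \<phi>" unfolding \<phi>_def by (rule continuous_on_vec_lambda)
  moreover have "x \<in> \<phi> ` {0..1}" if x: "\<forall>i. x $ i \<in> {0..1}" for x
  proof -
    have "\<forall>i. \<exists>d. (\<forall>n. d n \<in> {0, 1 :: real}) \<and> (\<lambda>n. d n / 2 ^ Suc n) sums (x $ i)"
      using x by (intro allI binary_expansion) auto
    then obtain d where d: "\<And>i n. d i n \<in> {0, 1 :: real}" "\<And>i. (\<lambda>n. d i n / 2 ^ Suc n) sums (x $ i)"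
      by metis
    define a where "a q = (case prod_decode q of (n, l) \<Rightarrow> d (inv e l) n)" for q
    have a: "a q \<in> {0, 1}" for q using d(1) by (simp add: a_def split: prod.split)
    have "a (k i n) = d i n" for i n using e by (simp add: a_def k_def)
    then have "\<phi> (ternary a) = x"
      using d(2) by (simp add: \<phi>_def c_def schoenberg_wave_digit[OF a] vec_eq_iff sums_iff)
    then show ?thesis using ternary_nonneg[of a, OF a] ternary_le_1[of a, OF a]
      by (intro image_eqI[of x \<phi> "ternary a"]) auto
  qed
  ultimately show ?thesis by blast
qed

section \<open>Transfer of measures to the unit interval\<close>

lemma compact_image_of_interval:
  fixes S :: "(real^'m) set"
  assumes "compact S"
  shows "\<exists>\<phi> :: real \<Rightarrow> real^'m. continuous_on UNIV \<phi> \<and> range \<phi> = \<phi> ` {0..1} \<and> S \<subseteq> \<phi> ` {0..1}"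
proof -
  obtain B where B: "\<And>x. x \<in> S \<Longrightarrow> norm x \<le> B" "B > 0"
    using compact_imp_bounded[OF assms] bounded_pos by blast
  obtain \<phi> :: "real \<Rightarrow> real^'m" where \<phi>: "continuous_on UNIV \<phi>" "{x. \<forall>i. x $ i \<in> {0..1}} \<subseteq> \<phi> ` {0..1}"
    using space_filling_curve by blast
  \<comment> \<open>Clamping the parameter makes the image of the line equal to that of
    \<open>[0, 1]\<close>, hence compact; continuous functions are then bounded along the
    curve.\<close>
  define c where "c t = max 0 (min 1 t)" for t :: real
  define \<psi> where "\<psi> t = (2 * B) *\<^sub>R (\<phi> (c t) - (\<chi> i. 1/2))" for t
  have "continuous_on UNIV c" unfolding c_def by (intro continuous_intros)
  then have "continuous_on UNIV \<psi>"
    unfolding \<psi>_def by (intro continuous_intros continuous_on_compose2[OF \<phi>(1)]) auto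
  moreover have "\<psi> t \<in> \<psi> ` {0..1}" for t
    by (rule image_eqI[of _ _ "c t"]) (auto simp: \<psi>_def c_def)
  moreover have "x \<in> \<psi> ` {0..1}" if x: "x \<in> S" for x
  proof -
    define y where "y = (1 / (2 * B)) *\<^sub>R x + (\<chi> i. 1/2)"
    have "\<bar>x $ i\<bar> \<le> B" for i using component_le_norm_cart[of x i] B(1)[OF x] by linarith
    then have "- B \<le> x $ i \<and> x $ i \<le> B" for i by (metis abs_le_iff minus_le_iff)
    then have "- (1/2) \<le> x $ i / (2 * B) \<and> x $ i / (2 * B) \<le> 1/2" for i
      using B(2) by (simp add: field_simps)
    moreover have "y $ i = x $ i / (2 * B) + 1/2" for i by (simp add: y_def)
    ultimately have "0 \<le> y $ i \<and> y $ i \<le> 1" for i by (smt (verit) field_sum_of_halves)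
    then have "y \<in> \<phi> ` {0..1}" using \<phi>(2) by auto
    then obtain t where "t \<in> {0..1}" "y = \<phi> t" by blast
    moreover have "(2 * B) *\<^sub>R (y - (\<chi> i. 1/2)) = x" using B(2) by (simp add: y_def)
    ultimately show ?thesis by (intro image_eqI[of _ _ t]) (auto simp: \<psi>_def c_def)
  qed
  ultimately show ?thesis by (intro exI[of _ \<psi>]) blast
qed

text \<open>The least preimage is lower semicontinuous, hence a Borel selection.\<close>

lemma borel_section:
  fixes \<phi> :: "real \<Rightarrow> real^'m"
  assumes cont: "continuous_on UNIV \<phi>"
  shows "\<exists>\<psi> \<in> borel_measurable borel. (\<forall>x. \<psi> x \<in> {0..1}) \<and> (\<forall>x \<in> \<phi> ` {0..1}. \<phi> (\<psi> x) = x)"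
proof -
  define F where "F x = {0..1} \<inter> \<phi> -` {x}" for x
  \<comment> \<open>With the value 1 off the curve, the sublevel sets at \<open>a < 1\<close> are
    exactly the images of \<open>[0, a]\<close>, which are compact.\<close>
  define \<psi> where "\<psi> x = (if x \<in> \<phi> ` {0..1} then Inf (F x) else 1)" for x
  have closedF: "closed (F x)" for x
    unfolding F_def by (intro closed_Int closed_vimage cont) auto
  have "Inf (F x) \<in> F x" if "x \<in> \<phi> ` {0..1}" for x
  proof (rule closed_contains_Inf[OF _ _ closedF])
    show "F x \<noteq> {}" using that by (auto simp: F_def)
    show "bdd_below (F x)" by (rule bdd_belowI[of _ 0]) (auto simp: F_def)
  qed
  then have in_F: "\<psi> x \<in> F x" if "x \<in> \<phi> ` {0..1}" for x using that by (simp add: \<psi>_def)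
  have least: "\<psi> x \<le> t" if "t \<in> {0..1}" "\<phi> t = x" for x t
    using that by (auto simp: \<psi>_def F_def intro!: cInf_lower bdd_belowI[of _ 0])
  have "\<psi> -` {..a} = (if a \<ge> 1 then UNIV else \<phi> ` {0..a})" for a
  proof -
    have "\<psi> x \<le> 1" for x using in_F[of x] by (cases "x \<in> \<phi> ` {0..1}") (auto simp: F_def, simp add: \<psi>_def)
    moreover have "\<psi> x \<le> a \<longleftrightarrow> x \<in> \<phi> ` {0..a}" if "a < 1" for x
    proof
      assume *: "\<psi> x \<le> a"
      then have "x \<in> \<phi> ` {0..1}" using that by (auto simp: \<psi>_def split: if_splits)
      then have "\<psi> x \<in> {0..1}" "x = \<phi> (\<psi> x)" using in_F by (auto simp: F_def)
      then show "x \<in> \<phi> ` {0..a}" using * by auto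
    qed (use least that in force)
    ultimately show ?thesis by (auto intro: order_trans)
  qed
  moreover have "closed (\<phi> ` {0..a})" for a
    by (rule compact_imp_closed, rule compact_continuous_image[OF continuous_on_subset[OF cont]]) auto
  ultimately have "\<psi> \<in> borel_measurable borel"
    by (intro borel_measurable_iff_le[THEN iffD2] allI) (auto simp: vimage_def)
  moreover have "\<psi> x \<in> {0..1}" for x
    using in_F[of x] by (cases "x \<in> \<phi> ` {0..1}") (auto simp: F_def, auto simp: \<psi>_def)
  ultimately show ?thesis using in_F by (intro bexI[of _ \<psi>]) (auto simp: F_def)
qed

text \<open>The section \<open>\<psi>\<close> carries the measures to \<open>[0, 1]\<close>, where
  they are tight, and \<open>\<phi>\<close> carries the limit back. Because
  \<open>\<phi> (\<psi> x) = x\<close> on \<open>S\<close>, no integral changes on the way.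
  Continuity is asked only of \<open>\<phi>\<close>, which enters the test functions; for
  \<open>\<psi>\<close> Borel measurability suffices.\<close>

theorem compact_support_convergent_subsequence:
  fixes \<mu> :: "nat \<Rightarrow> (real^'m) measure"
  assumes S: "compact S" "S \<noteq> {}" and ps: "\<And>n. prob_space (\<mu> n)" and sets: "\<And>n. sets (\<mu> n) = sets borel"
    and conc: "\<And>n. AE x in \<mu> n. x \<in> S"
  shows "\<exists>r M. strict_mono (r :: nat \<Rightarrow> nat) \<and> prob_space M \<and> sets M = sets borel \<and> (AE x in M. x \<in> S) \<and>
    (\<forall>f :: real^'m \<Rightarrow> real. continuous_on UNIV f \<longrightarrow>
      (\<lambda>n. \<integral>x. f x \<partial>\<mu> (r n)) \<longlonglongrightarrow> (\<integral>x. f x \<partial>M))"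
proof -
  obtain \<phi> :: "real \<Rightarrow> real^'m" where \<phi>: "continuous_on UNIV \<phi>" "S \<subseteq> \<phi> ` {0..1}" "range \<phi> = \<phi> ` {0..1}"
    using compact_image_of_interval[OF S(1)] by blast
  obtain \<psi> where \<psi>: "\<psi> \<in> borel_measurable borel" "\<And>x. \<psi> x \<in> {0..1}" "\<And>x. x \<in> \<phi> ` {0..1} \<Longrightarrow> \<phi> (\<psi> x) = x"
    using borel_section[OF \<phi>(1)] by blast
  have \<phi>m: "\<phi> \<in> borel_measurable borel" by (rule borel_measurable_continuous_onI[OF \<phi>(1)])
  have \<psi>m: "\<psi> \<in> measurable (\<mu> n) borel" for n
    using \<psi>(1) by (simp add: measurable_cong_sets[OF sets refl])
  define \<nu> where "\<nu> n = distr (\<mu> n) borel \<psi>" for n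
  have \<nu>: "real_distribution (\<nu> n)" for n
    unfolding \<nu>_def by (rule prob_space.real_distribution_distr[OF ps \<psi>m])
  have "tight \<nu>" unfolding tight_def
  proof (intro conjI allI impI)
    fix \<epsilon> :: real assume "\<epsilon> > 0"
    have "measure (\<nu> n) {-1<..1} = 1" for n
    proof -
      have "-1 < \<psi> x" "\<psi> x \<le> 1" for x using \<psi>(2)[of x] by auto
      then have "\<psi> -` {-1<..1} = UNIV" by auto
      then show ?thesis using prob_space.prob_space[OF ps] \<psi>m
        by (simp add: \<nu>_def measure_distr)
    qed
    then show "\<exists>a b. a < b \<and> (\<forall>n. 1 - \<epsilon> < measure (\<nu> n) {a<..b})"
      using \<open>\<epsilon> > 0\<close> by (intro exI[of _ "-1"] exI[of _ 1]) auto
  qed (rule \<nu>)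
  from tight_imp_convergent_subsubsequence[OF this, of id]
  obtain r N where r: "strict_mono (r :: nat \<Rightarrow> nat)" and N: "real_distribution N" and wc: "weak_conv_m (\<nu> \<circ> r) N"
    by (auto simp: strict_mono_def)
  interpret N: real_distribution N by fact
  define M where "M = distr N borel \<phi>"
  have \<phi>N: "\<phi> \<in> measurable N borel" using \<phi>m by simp
  have conv: "(\<lambda>n. \<integral>x. f x \<partial>\<mu> (r n)) \<longlonglongrightarrow> (\<integral>x. f x \<partial>M)"
    if f: "continuous_on UNIV f" for f :: "real^'m \<Rightarrow> real"
  proof -
    have fm: "f \<in> borel_measurable borel" by (rule borel_measurable_continuous_onI[OF f])
    have "compact (f ` \<phi> ` {0..1})"
      by (intro compact_continuous_image continuous_on_subset[OF f] continuous_on_subset[OF \<phi>(1)]) auto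
    then have "bounded (f ` range \<phi>)" unfolding \<phi>(3) by (rule compact_imp_bounded)
    then obtain B where B: "norm (f (\<phi> t)) \<le> B" for t by (auto simp: bounded_iff)
    have "(\<lambda>n. \<integral>t. f (\<phi> t) \<partial>(\<nu> \<circ> r) n) \<longlonglongrightarrow> (\<integral>t. f (\<phi> t) \<partial>N)"
    proof (rule weak_conv_imp_integral_bdd_continuous_conv[where B=B])
      have "continuous_on UNIV (\<lambda>t. f (\<phi> t))" by (rule continuous_on_compose2[OF f \<phi>(1)]) auto
      then show "isCont (\<lambda>t. f (\<phi> t)) x" for x by (simp add: continuous_on_eq_continuous_at)
    qed (use \<nu> N wc B in \<open>auto simp: comp_def\<close>)
    moreover have "(\<integral>t. f (\<phi> t) \<partial>\<nu> k) = (\<integral>x. f x \<partial>\<mu> k)" for k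
    proof -
      have "(\<integral>t. f (\<phi> t) \<partial>\<nu> k) = (\<integral>x. f (\<phi> (\<psi> x)) \<partial>\<mu> k)"
        unfolding \<nu>_def by (rule integral_distr[OF \<psi>m measurable_compose[OF \<phi>m fm]])
      also have "\<dots> = (\<integral>x. f x \<partial>\<mu> k)"
      proof (rule integral_cong_AE)
        show "AE x in \<mu> k. f (\<phi> (\<psi> x)) = f x"
          using conc[of k] by eventually_elim (use \<phi>(2) \<psi>(3) in auto)
      qed (use fm \<phi>m \<psi>m in \<open>auto simp: measurable_cong_sets[OF sets refl]\<close>)
      finally show ?thesis .
    qed
    moreover have "(\<integral>x. f x \<partial>M) = (\<integral>t. f (\<phi> t) \<partial>N)"
      unfolding M_def using fm by (intro integral_distr[OF \<phi>N])
    ultimately show ?thesis by simp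
  qed
  have M: "prob_space M" unfolding M_def by (rule N.prob_space_distr[OF \<phi>N])
  interpret M: prob_space M by (rule M)
  have "AE x in M. x \<in> S"
  proof -
    \<comment> \<open>This continuous function vanishes exactly on the closed set \<open>S\<close>;
      its integrals are 0 along the sequence, hence in the limit, which forces concentration on
      \<open>S\<close>.\<close>
    define f where "f x = min 1 (infdist x S)" for x
    have f: "continuous_on UNIV f" unfolding f_def by (intro continuous_intros)
    have fm: "f \<in> borel_measurable M"
      using borel_measurable_continuous_onI[OF f] by (simp add: M_def)
    have "(\<integral>x. f x \<partial>\<mu> k) = 0" for k
    proof (rule integral_eq_zero_AE)
      show "AE x in \<mu> k. f x = 0" using conc[of k] by eventually_elim (simp add: f_def)
    qed
    then have "(\<integral>x. f x \<partial>M) = 0" using conv[OF f] by (simp add: LIMSEQ_const_iff)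
    moreover have "integrable M f"
      by (rule M.integrable_const_bound[of _ 1]) (auto simp: f_def fm infdist_nonneg fm[unfolded f_def])
    ultimately have "AE x in M. f x = 0"
      by (subst (asm) integral_nonneg_eq_0_iff_AE) (auto simp: f_def infdist_nonneg)
    then show ?thesis
      by eventually_elim (use in_closed_iff_infdist_zero[OF compact_imp_closed[OF S(1)] S(2)] in \<open>auto simp: f_def min_def split: if_splits\<close>)
  qed
  moreover have "sets M = sets borel" by (simp add: M_def)
  ultimately show ?thesis using r M conv by blast
qed

section \<open>Moments on compact sets\<close>

definition concentrated_on :: "'a::topological_space set \<Rightarrow> 'a measure \<Rightarrow> bool" where
  "concentrated_on S M \<longleftrightarrow> prob_space M \<and> sets M = sets borel \<and> (AE x in M. x \<in> S)"

lemma integrable_concentrated_on: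
  fixes f :: "'a::topological_space \<Rightarrow> real"
  assumes "concentrated_on S M" "compact S" "continuous_on UNIV f"
  shows "integrable M f"
proof -
  interpret prob_space M using assms by (simp add: concentrated_on_def)
  have s: "sets M = sets borel" and ae: "AE x in M. x \<in> S" using assms by (auto simp: concentrated_on_def)
  have "compact (f ` S)" using assms by (intro compact_continuous_image) (auto intro: continuous_on_subset)
  then obtain B where B: "\<And>x. x \<in> S \<Longrightarrow> norm (f x) \<le> B"
    using compact_imp_bounded by (fastforce simp: bounded_iff)
  show ?thesis
  proof (rule integrable_const_bound)
    show "AE x in M. norm (f x) \<le> B" using ae by eventually_elim (rule B)
    show "f \<in> borel_measurable M"
      using borel_measurable_continuous_onI[OF assms(3)] by (simp add: measurable_cong_sets[OF s refl])
  qed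
qed

inductive monomial_comb :: "(real^'m \<Rightarrow> real) \<Rightarrow> bool" where
  monomial: "monomial_comb (\<lambda>x. c * (\<Prod>k\<in>UNIV. x $ k ^ \<gamma> k))"
| add: "monomial_comb f \<Longrightarrow> monomial_comb g \<Longrightarrow> monomial_comb (\<lambda>x. f x + g x)"

lemma monomial_comb_const: "monomial_comb (\<lambda>x. c)"
  using monomial[of c "\<lambda>_. 0"] by simp

lemma monomial_comb_scaled_component:
  fixes i :: "'m::finite"
  shows "monomial_comb (\<lambda>x. c * x $ i)"
proof -
  have "(\<Prod>k\<in>UNIV. x $ k ^ (if k = i then 1 else 0)) = x $ i" for x :: "real^'m"
  proof -
    have "(\<Prod>k\<in>UNIV. x $ k ^ (if k = i then 1 else 0)) = (\<Prod>k\<in>UNIV. if k = i then x $ k else 1)"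
      by (rule prod.cong) auto
    then show ?thesis by simp
  qed
  with monomial[of c "\<lambda>k. if k = i then 1 else 0"] show ?thesis by simp
qed

lemma monomial_comb_sum:
  assumes "finite A" "\<And>a. a \<in> A \<Longrightarrow> monomial_comb (f a)"
  shows "monomial_comb (\<lambda>x. \<Sum>a\<in>A. f a x)"
  using assms by (induction A rule: finite_induct) (auto intro: monomial_comb.add monomial_comb_const)

lemma monomial_comb_mult:
  assumes "monomial_comb f" "monomial_comb g"
  shows "monomial_comb (\<lambda>x. f x * g x)"
  using assms(1)
proof induction
  case (monomial c \<gamma>)
  show ?case using assms(2)
  proof induction
    case (monomial d \<delta>)
    show ?case using monomial_comb.monomial[of "c * d" "\<lambda>k. \<gamma> k + \<delta> k"]
      by (simp add: power_add prod.distrib mult_ac)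
  next
    case (add f g)
    then show ?case using monomial_comb.add by (simp add: distrib_left)
  qed
next
  case (add f g)
  then show ?case using monomial_comb.add by (simp add: distrib_right)
qed

lemma real_polynomial_function_imp_monomial_comb:
  fixes f :: "real^'m \<Rightarrow> real"
  assumes "real_polynomial_function f"
  shows "monomial_comb f"
  using assms
proof induction
  case (linear f)
  interpret bounded_linear f by fact
  have "f x = (\<Sum>i\<in>UNIV. f (axis i 1) * x $ i)" for x
  proof -
    have "f x = f (\<Sum>i\<in>UNIV. x $ i *\<^sub>R axis i 1)"
      using basis_expansion[of x] by (simp add: scalar_mult_eq_scaleR)
    also have "\<dots> = (\<Sum>i\<in>UNIV. f (axis i 1) * x $ i)" by (simp add: sum scaleR mult.commute)
    finally show ?thesis .
  qed
  then have "f = (\<lambda>x. \<Sum>i\<in>UNIV. f (axis i 1) * x $ i)" by blast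
  moreover have "monomial_comb \<dots>" by (intro monomial_comb_sum monomial_comb_scaled_component) auto
  ultimately show ?case by simp
qed (auto intro: monomial_comb_const monomial_comb.add monomial_comb_mult)

lemma monomial_comb_continuous: "monomial_comb f \<Longrightarrow> continuous_on UNIV f"
  by (induction rule: monomial_comb.induct) (auto intro!: continuous_intros)

text \<open>On \<open>S\<close> some polynomial is uniformly within \<open>r / 3\<close> of
  \<open>f\<close>. Replacing \<open>f\<close> by it costs at most \<open>r / 3\<close> under each
  measure concentrated on \<open>S\<close>, and integrals of polynomials converge with the
  moments.\<close>

theorem moments_convergence_imp_integral_convergence:
  fixes M :: "nat \<Rightarrow> (real^'m) measure"
  assumes S: "compact S" and M: "\<And>n. concentrated_on S (M n)" and \<mu>: "concentrated_on S \<mu>"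
    and mom: "\<And>\<gamma>. (\<lambda>n. \<integral>x. (\<Prod>k\<in>UNIV. x $ k ^ \<gamma> k) \<partial>M n) \<longlonglongrightarrow> (\<integral>x. (\<Prod>k\<in>UNIV. x $ k ^ \<gamma> k) \<partial>\<mu>)"
    and f: "continuous_on UNIV f"
  shows "(\<lambda>n. \<integral>x. f x \<partial>M n) \<longlonglongrightarrow> (\<integral>x. f x \<partial>\<mu> :: real)"
proof -
  have conv_comb: "(\<lambda>n. \<integral>x. g x \<partial>M n) \<longlonglongrightarrow> (\<integral>x. g x \<partial>\<mu>)" if "monomial_comb g" for g
    using that
  proof induction
    case (monomial c \<gamma>)
    show ?case using tendsto_mult[OF tendsto_const mom, of c] by simp
  next
    case (add f g)
    then show ?case
      using integrable_concentrated_on[OF M S] integrable_concentrated_on[OF \<mu> S]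
      by (auto simp: monomial_comb_continuous intro!: tendsto_intros)
  qed
  have close: "\<bar>(\<integral>x. f x \<partial>N) - (\<integral>x. g x \<partial>N)\<bar> \<le> e"
    if N: "concentrated_on S N" and g: "continuous_on UNIV g" "\<And>x. x \<in> S \<Longrightarrow> \<bar>f x - g x\<bar> < e" for N g e
  proof -
    interpret N: prob_space N using N by (simp add: concentrated_on_def)
    have i: "integrable N f" "integrable N g" using integrable_concentrated_on[OF N S] f g by auto
    have "\<bar>(\<integral>x. f x \<partial>N) - (\<integral>x. g x \<partial>N)\<bar> = \<bar>\<integral>x. f x - g x \<partial>N\<bar>" using i by simp
    also have "\<dots> \<le> (\<integral>x. \<bar>f x - g x\<bar> \<partial>N)" by (rule integral_abs_bound)
    also have "\<dots> \<le> (\<integral>x. e \<partial>N)"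
    proof (rule integral_mono_AE)
      show "AE x in N. \<bar>f x - g x\<bar> \<le> e"
        using N unfolding concentrated_on_def by (auto elim!: eventually_mono dest: g(2))
    qed (use i in auto)
    finally show ?thesis using N.prob_space by simp
  qed
  show ?thesis
  proof (rule LIMSEQ_I)
    fix r :: real assume "r > 0"
    obtain g where "real_polynomial_function g" and g: "\<And>x. x \<in> S \<Longrightarrow> \<bar>f x - g x\<bar> < r / 3"
      using Stone_Weierstrass_real_polynomial_function[OF S continuous_on_subset[OF f], of "r / 3"] \<open>r > 0\<close> by auto
    then have mg: "monomial_comb g" by (intro real_polynomial_function_imp_monomial_comb)
    have cg: "continuous_on UNIV g" by (rule monomial_comb_continuous[OF mg])
    obtain n0 where n0: "\<And>n. n \<ge> n0 \<Longrightarrow> norm ((\<integral>x. g x \<partial>M n) - (\<integral>x. g x \<partial>\<mu>)) < r / 3"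
      using LIMSEQ_D[OF conv_comb[OF mg], of "r / 3"] \<open>r > 0\<close> by auto
    show "\<exists>n0. \<forall>n\<ge>n0. norm ((\<integral>x. f x \<partial>M n) - (\<integral>x. f x \<partial>\<mu>)) < r"
    proof (intro exI[of _ n0] allI impI)
      fix n assume "n \<ge> n0"
      from n0[OF this] close[OF M cg g, of n] close[OF \<mu> cg g]
      show "norm ((\<integral>x. f x \<partial>M n) - (\<integral>x. f x \<partial>\<mu>)) < r"
        unfolding real_norm_def by linarith
    qed
  qed
qed

section \<open>Uniqueness of measures\<close>

text \<open>The functions \<open>max 0 (1 - n * infdist x C)\<close> decrease to the indicator of a
  nonempty closed set \<open>C\<close>, and the closed sets form an intersection-stable generator of
  the Borel sets.\<close>

lemma measure_eqI_bounded_continuous: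
  fixes M N :: "'a::metric_space measure"
  assumes M: "prob_space M" "sets M = sets borel" and N: "prob_space N" "sets N = sets borel"
    and eq: "\<And>f :: 'a \<Rightarrow> real. continuous_on UNIV f \<Longrightarrow> bounded (range f) \<Longrightarrow> (\<integral>x. f x \<partial>M) = (\<integral>x. f x \<partial>N)"
  shows "M = N"
proof -
  interpret M: prob_space M by fact
  interpret N: prob_space N by fact
  have le_1: "norm (max 0 (1 - real n * infdist x C)) \<le> 1" for n x and C :: "'a set"
  proof -
    have "0 \<le> real n * infdist x C" by (simp add: infdist_nonneg)
    then show ?thesis by simp
  qed
  have conv: "(\<lambda>n. \<integral>x. max 0 (1 - real n * infdist x C) \<partial>P) \<longlonglongrightarrow> measure P C"
    if P: "prob_space P" "sets P = sets borel" and C: "closed C" "C \<noteq> {}" for P and C :: "'a set"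
  proof -
    interpret P: prob_space P by fact
    have CP: "C \<in> sets P" using P(2) C by simp
    have "(\<lambda>n. \<integral>x. max 0 (1 - real n * infdist x C) \<partial>P) \<longlonglongrightarrow> (\<integral>x. indicator C x \<partial>P)"
    proof (rule integral_dominated_convergence[where w = "\<lambda>_. 1"])
      show "AE x in P. (\<lambda>n. max 0 (1 - real n * infdist x C)) \<longlonglongrightarrow> indicator C x"
      proof (rule AE_I2)
        fix x
        show "(\<lambda>n. max 0 (1 - real n * infdist x C)) \<longlonglongrightarrow> indicator C x"
        proof (cases "x \<in> C")
          case False
          then have pos: "infdist x C > 0"
            using in_closed_iff_infdist_zero[OF C, of x] infdist_nonneg[of x C] by linarith
          obtain m where m: "real m > 1 / infdist x C" using reals_Archimedean2 by blast
          have "\<forall>\<^sub>F n in sequentially. max 0 (1 - real n * infdist x C) = 0"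
          proof (rule eventually_sequentiallyI)
            fix n assume "n \<ge> m"
            then have "real n > 1 / infdist x C" using m by linarith
            then show "max 0 (1 - real n * infdist x C) = 0" using pos by (simp add: field_simps)
          qed
          then show ?thesis using False by (simp add: tendsto_eventually)
        qed auto
      qed
      show "AE x in P. norm (max 0 (1 - real n * infdist x C)) \<le> 1" for n
        by (rule AE_I2) (rule le_1)
      show "(\<lambda>x. max 0 (1 - real n * infdist x C)) \<in> borel_measurable P" for n
        unfolding measurable_cong_sets[OF P(2) refl]
        by (intro borel_measurable_continuous_onI continuous_intros)
    qed (use CP in auto)
    then show ?thesis using CP by simp
  qed
  have closed_eq: "measure M C = measure N C" if C: "closed C" for C
  \<comment> \<open>\<open>infdist\<close> to the empty set is 0 by convention, so these functions
    do not approximate its indicator.\<close>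
  proof (cases "C = {}")
    case False
    have "(\<integral>x. max 0 (1 - real n * infdist x C) \<partial>M) = (\<integral>x. max 0 (1 - real n * infdist x C) \<partial>N)" for n
      by (intro eq continuous_intros boundedI[of _ 1]) (use le_1 in blast)
    then show ?thesis using LIMSEQ_unique[OF conv[OF M C False]] conv[OF N C False] by simp
  qed simp
  show ?thesis
  proof (rule measure_eqI_generator_eq[where E = "Collect closed" and \<Omega> = UNIV and A = "\<lambda>_. UNIV"])
    show "Int_stable (Collect closed)" by (auto simp: Int_stable_def)
    show "sets M = sigma_sets UNIV (Collect closed)" "sets N = sigma_sets UNIV (Collect closed)"
      using M(2) N(2) by (auto simp: borel_eq_closed)
    show "emeasure M X = emeasure N X" if "X \<in> Collect closed" for X
      using closed_eq that by (simp add: M.emeasure_eq_measure N.emeasure_eq_measure)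
  qed auto
qed

lemma moments_determine_measure:
  fixes \<mu> \<nu> :: "(real^'m) measure"
  assumes S: "compact S" and \<mu>: "concentrated_on S \<mu>" and \<nu>: "concentrated_on S \<nu>"
    and eq: "\<And>\<gamma>. (\<integral>x. (\<Prod>k\<in>UNIV. x $ k ^ \<gamma> k) \<partial>\<mu>) = (\<integral>x. (\<Prod>k\<in>UNIV. x $ k ^ \<gamma> k) \<partial>\<nu>)"
  shows "\<mu> = \<nu>"
proof (rule measure_eqI_bounded_continuous)
  fix f :: "real^'m \<Rightarrow> real" assume f: "continuous_on UNIV f"
  have "(\<lambda>n :: nat. \<integral>x. f x \<partial>\<mu>) \<longlonglongrightarrow> (\<integral>x. f x \<partial>\<nu>)"
    by (intro moments_convergence_imp_integral_convergence[where M = "\<lambda>_. \<mu>", OF S \<mu> \<nu> _ f])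
       (unfold eq, rule tendsto_const)
  then show "(\<integral>x. f x \<partial>\<mu>) = (\<integral>x. f x \<partial>\<nu>)" by (simp add: LIMSEQ_const_iff)
qed (use \<mu> \<nu> in \<open>auto simp: concentrated_on_def\<close>)

section \<open>Asymptotics of linear recursions\<close>

definition l1 :: "real^'m \<Rightarrow> real" where
  "l1 x = (\<Sum>j\<in>UNIV. \<bar>x $ j\<bar>)"

lemma l1_nonneg: "0 \<le> l1 x"
  by (simp add: l1_def sum_nonneg)

lemma abs_le_l1: "\<bar>x $ j\<bar> \<le> l1 x"
  unfolding l1_def by (rule member_le_sum) auto

lemma l1_zero [simp]: "l1 0 = 0"
  by (simp add: l1_def)

lemma l1_eq_0: "l1 x = 0 \<Longrightarrow> x = 0"
  unfolding l1_def by (subst (asm) sum_nonneg_eq_0_iff) (auto simp: vec_eq_iff)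

lemma l1_add: "l1 (x + y) \<le> l1 x + l1 y"
  unfolding l1_def by (simp add: sum.distrib[symmetric] sum_mono abs_triangle_ineq)

lemma l1_scaleR: "l1 (c *\<^sub>R x) = \<bar>c\<bar> * l1 x"
  by (simp add: l1_def abs_mult sum_distrib_left)

lemma tendsto_l1: "(f \<longlongrightarrow> a) F \<Longrightarrow> ((\<lambda>x. l1 (f x)) \<longlongrightarrow> l1 a) F"
  unfolding l1_def by (intro tendsto_intros)

lemma tendsto_l1_imp_tendsto:
  assumes "((\<lambda>x. l1 (f x - a)) \<longlongrightarrow> 0) F"
  shows "(f \<longlongrightarrow> a) F"
proof (rule vec_tendstoI)
  fix i
  have "\<bar>f x $ i - a $ i\<bar> \<le> l1 (f x - a)" for x using abs_le_l1[of "f x - a" i] by simp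
  then have "((\<lambda>x. f x $ i - a $ i) \<longlongrightarrow> 0) F"
    by (intro Lim_null_comparison[OF _ assms] always_eventually) auto
  then show "((\<lambda>x. f x $ i) \<longlongrightarrow> a $ i) F" by (simp add: LIM_zero_iff)
qed

lemma tendsto_vector_matrix_mult [tendsto_intros]:
  fixes f :: "'a \<Rightarrow> real^'m" and A :: "'a \<Rightarrow> real^'n^'m"
  assumes "(f \<longlongrightarrow> a) F" "(A \<longlongrightarrow> B) F"
  shows "((\<lambda>x. f x v* A x) \<longlongrightarrow> a v* B) F"
  unfolding vector_matrix_mult_def by (intro vec_tendstoI) (auto intro!: tendsto_intros assms)

text \<open>Doeblin's contraction: on vectors of total mass \<open>0\<close> the common part \<open>\<delta>\<close> of all rows cancels.\<close>

lemma l1_stochastic_le: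
  fixes P :: "real^'m^'m"
  assumes P: "\<And>i j. \<delta> \<le> P $ i $ j" "\<And>i. (\<Sum>j\<in>UNIV. P $ i $ j) = 1"
    and x: "\<delta> * (\<Sum>i\<in>UNIV. x $ i) = 0"
  shows "l1 (x v* P) \<le> (1 - real CARD('m) * \<delta>) * l1 x"
proof -
  have "(x v* P) $ j = (\<Sum>i\<in>UNIV. x $ i * (P $ i $ j - \<delta>))" for j
    using x by (simp add: vector_matrix_mult_def right_diff_distrib sum_subtractf sum_distrib_left[symmetric] mult.commute)
  then have "l1 (x v* P) \<le> (\<Sum>j\<in>UNIV. \<Sum>i\<in>UNIV. \<bar>x $ i\<bar> * (P $ i $ j - \<delta>))"
    unfolding l1_def using P(1)
    by (auto intro!: sum_mono order_trans[OF sum_abs] simp: abs_mult)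
  also have "\<dots> = (\<Sum>i\<in>UNIV. \<bar>x $ i\<bar> * (\<Sum>j\<in>UNIV. P $ i $ j - \<delta>))"
    by (subst sum.swap) (simp add: sum_distrib_left)
  also have "\<dots> = (1 - real CARD('m) * \<delta>) * l1 x"
    by (simp add: sum_subtractf P(2) l1_def sum_distrib_left mult.commute)
  finally show ?thesis .
qed

section \<open>Transition matrices and the stationary vector\<close>

text \<open>The case \<open>\<delta> = 0\<close> of the Doeblin bound, where the mass condition
  holds for every vector.\<close>

lemma transition_l1_le:
  assumes "G \<in> generators"
  shows "l1 (x v* transition G 1 n) \<le> l1 x"
  using l1_stochastic_le[of 0 "transition G 1 n" x] transition_stochastic[OF assms zero_less_one, of n] by simp

lemma transition_eq:
  assumes "threshold G 1 < n"
  shows "transition G 1 n = mat 1 + (1 / real n) *\<^sub>R G"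
  using assms by (simp add: transition_def)

lemma eventually_transition_eq:
  "\<forall>\<^sub>F n in sequentially. transition G 1 (Suc n) = mat 1 + (1 / real (Suc n)) *\<^sub>R G"
  using eventually_ge_at_top[of "threshold G 1"] by eventually_elim (simp add: transition_eq)

lemma transition_tendsto: "(\<lambda>n. transition G 1 (Suc n)) \<longlonglongrightarrow> mat 1"
proof (rule Lim_transform_eventually)
  have "(\<lambda>n. mat 1 + (1 / real (Suc n)) *\<^sub>R G) \<longlonglongrightarrow> mat 1 + 0 *\<^sub>R G"
    by (intro tendsto_intros LIMSEQ_Suc[OF lim_1_over_n])
  then show "(\<lambda>n. mat 1 + (1 / real (Suc n)) *\<^sub>R G) \<longlonglongrightarrow> mat 1" by simp
qed (use eventually_transition_eq[of G] in \<open>auto elim: eventually_mono\<close>)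

lemma generator_row_sum:
  assumes "G \<in> generators"
  shows "(\<Sum>j\<in>UNIV. G $ i $ j) = 0"
proof -
  have "(\<Sum>j\<in>UNIV. G $ i $ j) = G $ i $ i + (\<Sum>j\<in>UNIV - {i}. G $ i $ j)" by (rule sum.remove) auto
  then show ?thesis using assms by (simp add: generators_def)
qed

text \<open>Off the diagonal the entries are \<open>G $ i $ j / n\<close>, on it they tend to 1, so
  eventually all are at least a fixed multiple of \<open>1 / n\<close>. The order matters: the
  resulting contraction rates have a divergent sum.\<close>

lemma transition_minorized:
  fixes G :: "real^'m^'m"
  assumes G: "G \<in> generators"
  shows "\<exists>\<delta>>0. real CARD('m) * \<delta> \<le> 1 \<and> (\<exists>N. \<forall>n\<ge>N. \<forall>i j. \<delta> / real n \<le> transition G 1 n $ i $ j)"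
proof -
  \<comment> \<open>The element \<open>1 / real CARD('m)\<close> yields
    \<open>real CARD('m) * \<delta> \<le> 1\<close> and makes \<open>Q\<close> nonempty.\<close>
  define Q where "Q = insert (1 / real CARD('m)) {G $ i $ j | i j. i \<noteq> j}"
  have "{G $ i $ j | i j. i \<noteq> j} \<subseteq> (\<lambda>(i,j). G $ i $ j) ` UNIV" by auto
  then have "finite {G $ i $ j | i j. i \<noteq> j}" by (rule finite_subset) simp
  then have "finite Q" unfolding Q_def by simp
  define \<delta> where "\<delta> = Min Q"
  have \<delta>: "\<delta> > 0"
    unfolding \<delta>_def using \<open>finite Q\<close> G by (subst Min_gr_iff) (auto simp: Q_def generators_def)
  have "\<delta> \<le> 1 / real CARD('m)" unfolding \<delta>_def using \<open>finite Q\<close> by (intro Min_le) (auto simp: Q_def)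
  then have \<delta>1: "real CARD('m) * \<delta> \<le> 1" by (simp add: field_simps)
  have off: "\<delta> \<le> G $ i $ j" if "i \<noteq> j" for i j
    unfolding \<delta>_def using \<open>finite Q\<close> that by (intro Min_le) (auto simp: Q_def)
  \<comment> \<open>The l1 norm of the diagonal bounds all its entries at once; from this time on
    \<open>1 + G $ i $ i / n\<close> is at least \<open>\<delta> / n\<close>.\<close>
  obtain N1 :: nat where N1: "real N1 \<ge> l1 (\<chi> i. G $ i $ i) + \<delta>" using real_arch_simple by blast
  define N where "N = max (Suc (threshold G 1)) N1"
  have "\<delta> / real n \<le> transition G 1 n $ i $ j" if n: "n \<ge> N" for n i j
  proof (cases "i = j")
    case True
    have "\<bar>G $ i $ i\<bar> + \<delta> \<le> real N1" using N1 abs_le_l1[of "\<chi> i. G $ i $ i" i] by simp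
    then have "\<delta> \<le> real n + G $ i $ i" using n unfolding N_def by linarith
    moreover have "n > 0" "threshold G 1 < n" using n unfolding N_def by auto
    ultimately show ?thesis using True by (simp add: transition_eq mat_def field_simps)
  next
    case False
    moreover have "threshold G 1 < n" using n unfolding N_def by auto
    ultimately show ?thesis using off[OF False] by (simp add: transition_eq mat_def divide_right_mono)
  qed
  then show ?thesis using \<delta> \<delta>1 by blast
qed

text \<open>Supplies a positive stochastic matrix past the threshold, where the left fixed vectors
  are the left null vectors of \<open>G\<close>.\<close>

lemma ex_positive_transition:
  fixes G :: "real^'m^'m"
  assumes "G \<in> generators"
  shows "\<exists>n \<delta>. n > threshold G 1 \<and> \<delta> > 0 \<and> (\<forall>i j. \<delta> \<le> transition G 1 n $ i $ j)"
proof -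
  obtain \<delta> N where "\<delta> > 0" and N: "\<And>n i j. n \<ge> N \<Longrightarrow> \<delta> / real n \<le> transition G 1 n $ i $ j"
    using transition_minorized[OF assms] by blast
  then show ?thesis
    by (intro exI[of _ "max N (Suc (threshold G 1))"] exI[of _ "\<delta> / real (max N (Suc (threshold G 1)))"]) auto
qed

lemma left_kernel_iff_fixed:
  assumes "threshold G 1 < n"
  shows "v v* transition G 1 n = v \<longleftrightarrow> v v* G = 0"
proof -
  have "v v* transition G 1 n = v + (1 / real n) *\<^sub>R (v v* G)"
    using assms by (simp add: transition_eq vector_matrix_mult_add_rdistrib vector_scaleR_matrix_ac)
  then show ?thesis using assms by auto
qed

text \<open>A null vector is fixed by a positive transition matrix; having mass 0, it would also be
  shrunk strictly unless it vanishes.\<close>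

lemma left_kernel_sum_zero:
  fixes G :: "real^'m^'m"
  assumes G: "G \<in> generators" and d: "d v* G = 0" "(\<Sum>i\<in>UNIV. d $ i) = 0"
  shows "d = 0"
proof -
  obtain n \<delta> where n: "n > threshold G 1" and \<delta>: "\<delta> > 0" "\<And>i j. \<delta> \<le> transition G 1 n $ i $ j"
    using ex_positive_transition[OF G] by blast
  have "l1 (d v* transition G 1 n) \<le> (1 - real CARD('m) * \<delta>) * l1 d"
    using \<delta>(2) transition_stochastic(2)[OF G zero_less_one] d(2) by (intro l1_stochastic_le) auto
  then have "real CARD('m) * \<delta> * l1 d \<le> 0"
    using left_kernel_iff_fixed[OF n, of d] d(1) by (simp add: algebra_simps)
  moreover have "real CARD('m) * \<delta> > 0" using \<delta>(1) by simp
  ultimately have "l1 d \<le> 0" by (smt (verit) mult_pos_pos)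
  then show ?thesis using l1_nonneg[of d] by (intro l1_eq_0) simp
qed

text \<open>Zero row sums make \<open>G\<close> annihilate the constant column vector, so
  \<open>G\<close> is singular and so is its transpose.\<close>

lemma left_kernel_nontrivial:
  fixes G :: "real^'m^'m"
  assumes G: "G \<in> generators"
  shows "\<exists>v. v v* G = 0 \<and> v \<noteq> 0"
proof (rule ccontr)
  assume "\<not> ?thesis"
  then have "\<forall>v. transpose G *v v = 0 \<longrightarrow> v = 0" by auto
  then have "invertible (transpose G)" by (metis matrix_left_invertible_ker invertible_left_inverse)
  then have "invertible G" using transpose_invertible[of "transpose G"] by simp
  then have "G *v (\<chi> i. 1) = 0 \<longrightarrow> (\<chi> i. 1 :: real^'m) = 0"
    by (metis matrix_left_invertible_ker invertible_left_inverse)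
  moreover have "G *v (\<chi> i. 1) = 0"
    using generator_row_sum[OF G] by (simp add: matrix_vector_mult_def vec_eq_iff)
  ultimately show False by (simp add: vec_eq_iff)
qed

text \<open>Perron: the entrywise absolute value of a left null vector is again a left null vector.\<close>

lemma ex1_stationary:
  fixes G :: "real^'m^'m"
  assumes G: "G \<in> generators"
  shows "\<exists>!v. v v* G = 0 \<and> (\<forall>i. v $ i > 0) \<and> (\<Sum>i\<in>UNIV. v $ i) = 1"
proof (rule ex_ex1I)
  obtain n \<delta> where n: "n > threshold G 1" and \<delta>: "\<delta> > 0" "\<And>i j. \<delta> \<le> transition G 1 n $ i $ j"
    using ex_positive_transition[OF G] by blast
  define P where "P = transition G 1 n"
  have P: "P $ i $ j > 0" for i j using \<delta> unfolding P_def by (metis order_less_le_trans)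
  have P1: "(\<Sum>j\<in>UNIV. P $ i $ j) = 1" for i
    unfolding P_def by (rule transition_stochastic(2)[OF G zero_less_one])
  obtain v where v: "v v* G = 0" "v \<noteq> 0" using left_kernel_nontrivial[OF G] by blast
  then have vP: "v v* P = v" using left_kernel_iff_fixed[OF n] unfolding P_def by blast
  define u where "u = (\<chi> j. \<bar>v $ j\<bar>)"
  have le: "u $ j \<le> (u v* P) $ j" for j
  proof -
    have "u $ j = \<bar>(v v* P) $ j\<bar>" by (simp add: vP u_def)
    also have "\<dots> \<le> (\<Sum>i\<in>UNIV. \<bar>v $ i * P $ i $ j\<bar>)" by (simp add: vector_matrix_mult_def)
    also have "\<dots> = (u v* P) $ j" using P by (simp add: vector_matrix_mult_def u_def abs_mult less_imp_le)
    finally show ?thesis .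
  qed
  have "(\<Sum>j\<in>UNIV. (u v* P) $ j) = (\<Sum>i\<in>UNIV. u $ i * (\<Sum>j\<in>UNIV. P $ i $ j))"
    unfolding vector_matrix_mult_def by (simp add: sum_distrib_left) (rule sum.swap)
  then have "(\<Sum>j\<in>UNIV. u $ j) = (\<Sum>j\<in>UNIV. (u v* P) $ j)" by (simp add: P1)
  \<comment> \<open>\<open>P\<close> preserves total mass, and an entrywise inequality between
    vectors of equal mass is an equality.\<close>
  then have eq: "u v* P = u"
    using sum_mono_inv[of "\<lambda>j. u $ j" UNIV "\<lambda>j. (u v* P) $ j"] le by (simp add: vec_eq_iff)
  then have uG: "u v* G = 0" using left_kernel_iff_fixed[OF n] unfolding P_def by blast
  obtain k where "v $ k \<noteq> 0" using v(2) by (auto simp: vec_eq_iff)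
  have pos: "u $ j > 0" for j
  proof -
    have "0 < u $ k * P $ k $ j" using \<open>v $ k \<noteq> 0\<close> P by (simp add: u_def)
    also have "\<dots> \<le> (\<Sum>i\<in>UNIV. u $ i * P $ i $ j)"
      using P by (intro member_le_sum) (auto simp: u_def less_imp_le)
    also have "\<dots> = u $ j" using eq by (simp add: vector_matrix_mult_def vec_eq_iff)
    finally show ?thesis .
  qed
  define s where "s = (\<Sum>j\<in>UNIV. u $ j)"
  have s: "s > 0" unfolding s_def using pos by (intro sum_pos) auto
  have "(1 / s) *\<^sub>R u v* G = 0 \<and> (\<forall>i. ((1 / s) *\<^sub>R u) $ i > 0) \<and> (\<Sum>i\<in>UNIV. ((1 / s) *\<^sub>R u) $ i) = 1"
    using uG pos s by (simp add: scaleR_vector_matrix_assoc sum_divide_distrib[symmetric] s_def[symmetric])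
  then show "\<exists>v. v v* G = 0 \<and> (\<forall>i. v $ i > 0) \<and> (\<Sum>i\<in>UNIV. v $ i) = 1" by blast
next
  fix v w
  assume v: "v v* G = 0 \<and> (\<forall>i. v $ i > 0) \<and> (\<Sum>i\<in>UNIV. v $ i) = 1"
    and w: "w v* G = 0 \<and> (\<forall>i. w $ i > 0) \<and> (\<Sum>i\<in>UNIV. w $ i) = 1"
  have "(v - w) v* G = 0" unfolding vector_matrix_mult_diff_distrib using v w by simp
  moreover have "(\<Sum>i\<in>UNIV. (v - w) $ i) = 0" using v w by (simp add: sum_subtractf)
  ultimately have "v - w = 0" by (rule left_kernel_sum_zero[OF G])
  then show "v = w" by simp
qed

lemma
  assumes G: "G \<in> generators"
  shows stationary_left_kernel: "stationary G v* G = 0"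
    and stationary_sum: "(\<Sum>i\<in>UNIV. stationary G $ i) = 1"
  using theI'[OF ex1_stationary[OF G]] unfolding stationary_def by auto

lemma stationary_transition:
  assumes "G \<in> generators"
  shows "stationary G v* transition G 1 n = stationary G"
proof (cases "threshold G 1 < n")
  case True
  then show ?thesis using left_kernel_iff_fixed stationary_left_kernel[OF assms] by blast
qed (simp add: transition_def)

lemma resolvent_left_inverse:
  fixes G :: "real^'m^'m"
  assumes "G \<in> generators" "x > 0"
  shows "resolvent G x ** (mat x - G) = mat 1"
  using someI_ex[OF invertible_resolvent[OF assms, unfolded invertible_def]]
  unfolding resolvent_def matrix_inv_def by blast

text \<open>\<open>mat x - G\<close> maps the constant vector 1 to the constant vector
  \<open>x\<close>; apply the inverse.\<close>

lemma resolvent_row_sum: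
  fixes G :: "real^'m^'m"
  assumes G: "G \<in> generators" and x: "x > 0"
  shows "(\<Sum>j\<in>UNIV. resolvent G x $ i $ j) = 1 / x"
proof -
  have "(mat x - G) *v (\<chi> i. 1) = (\<chi> i. x)"
    using generator_row_sum[OF G]
    by (simp add: matrix_vector_mult_def mat_def vec_eq_iff sum_subtractf)
  then have "resolvent G x *v (\<chi> i. x) = (resolvent G x ** (mat x - G)) *v (\<chi> i. 1)"
    by (simp add: matrix_vector_mul_assoc[symmetric])
  then have "(resolvent G x *v (\<chi> i. x)) $ i = 1"
    by (simp add: resolvent_left_inverse[OF assms])
  then show ?thesis using x by (simp add: matrix_vector_mult_def sum_distrib_right[symmetric] sum_distrib_left[symmetric] field_simps)
qed

section \<open>Limits of the recursions\<close>

text \<open>The weight \<open>(n + 1) powr c\<close> makes the sequence eventually nonincreasing: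
  \<open>1 - c / (n + 1)\<close> is at most \<open>exp (- c / (n + 1))\<close>, and one step
  multiplies the weight by at most \<open>exp (c / (n + 1))\<close>. So \<open>x n\<close> is of
  order \<open>n powr - c\<close> at most.\<close>

lemma contraction_tendsto_0:
  fixes x :: "nat \<Rightarrow> real"
  assumes c: "0 < c" "c \<le> 1" and nn: "\<And>n. 0 \<le> x n"
    and le: "\<And>n. n \<ge> N \<Longrightarrow> x (Suc n) \<le> (1 - c / real (Suc n)) * x n"
  shows "x \<longlonglongrightarrow> 0"
proof -
  define y where "y n = x n * real (Suc n) powr c" for n
  have "y (Suc n) \<le> y n" if "n \<ge> N" for n
  proof -
    have "ln (1 + 1 / real (Suc n)) \<le> 1 / real (Suc n)" by (rule ln_add_one_self_le_self) simp
    moreover have "1 + 1 / real (Suc n) = real (Suc (Suc n)) / real (Suc n)"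
      by (simp add: field_simps)
    ultimately have "c * ln (real (Suc (Suc n)) / real (Suc n)) \<le> c * (1 / real (Suc n))"
      using c by (intro mult_left_mono) auto
    then have *: "(real (Suc (Suc n)) / real (Suc n)) powr c \<le> exp (c / real (Suc n))"
      by (simp add: powr_def)
    have "x (Suc n) \<le> exp (- c / real (Suc n)) * x n"
      using le[OF that] exp_ge_add_one_self[of "- c / real (Suc n)"] nn[of n]
      by (smt (verit) mult_right_mono minus_divide_left)
    then have "x (Suc n) * real (Suc (Suc n)) powr c
        \<le> exp (- c / real (Suc n)) * x n * ((real (Suc (Suc n)) / real (Suc n)) powr c * real (Suc n) powr c)"
      by (simp add: powr_divide mult_right_mono)
    also have "\<dots> \<le> exp (- c / real (Suc n)) * x n * (exp (c / real (Suc n)) * real (Suc n) powr c)"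
      using * nn by (intro mult_left_mono mult_right_mono) auto
    also have "\<dots> = y n" by (simp add: y_def exp_minus field_simps)
    finally show ?thesis by (simp add: y_def)
  qed
  note y_mono = this
  have yN: "y n \<le> y N" if "n \<ge> N" for n
    using that
  proof (induction n rule: dec_induct)
    case (step n)
    then show ?case using y_mono[of n] by simp
  qed simp
  have "\<forall>\<^sub>F n in sequentially. x n \<le> y N * real (Suc n) powr - c"
  proof (rule eventually_sequentiallyI)
    fix n assume "n \<ge> N"
    then have "x n * real (Suc n) powr c \<le> y N" using yN unfolding y_def by blast
    then show "x n \<le> y N * real (Suc n) powr - c" by (simp add: powr_minus field_simps)
  qed
  moreover have "(\<lambda>n. y N * real (Suc n) powr - c) \<longlonglongrightarrow> y N * 0"
    using c by (intro tendsto_intros tendsto_neg_powr filterlim_compose[OF filterlim_real_sequentially filterlim_Suc]) auto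
  ultimately show ?thesis
    using nn by (intro tendsto_sandwich[of "\<lambda>_. 0" x sequentially]) auto
qed

text \<open>The stationary vector is fixed by every transition matrix, so
  \<open>p n - stationary G\<close> evolves by the same matrices. It has mass 0, and Doeblin's bound
  applies.\<close>

lemma law_tendsto_stationary:
  fixes G :: "real^'m^'m"
  assumes G: "G \<in> generators" and p: "\<And>n. p (Suc n) = p n v* transition G 1 (Suc n)"
    and sum1: "\<And>n. (\<Sum>i\<in>UNIV. p n $ i) = 1"
  shows "p \<longlonglongrightarrow> stationary G"
proof (rule tendsto_l1_imp_tendsto)
  obtain \<delta> N where \<delta>: "\<delta> > 0" "real CARD('m) * \<delta> \<le> 1"
    and N: "\<And>n i j. n \<ge> N \<Longrightarrow> \<delta> / real n \<le> transition G 1 n $ i $ j"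
    using transition_minorized[OF G] by blast
  show "(\<lambda>n. l1 (p n - stationary G)) \<longlonglongrightarrow> 0"
  proof (rule contraction_tendsto_0)
    fix n assume n: "n \<ge> N"
    have "p (Suc n) - stationary G = (p n - stationary G) v* transition G 1 (Suc n)"
      by (simp add: p vector_matrix_mult_diff_distrib stationary_transition[OF G])
    also have "l1 \<dots> \<le> (1 - real CARD('m) * (\<delta> / real (Suc n))) * l1 (p n - stationary G)"
      using N[of "Suc n"] n transition_stochastic(2)[OF G zero_less_one] sum1 stationary_sum[OF G]
      by (intro l1_stochastic_le) (auto simp: sum_subtractf)
    finally show "l1 (p (Suc n) - stationary G) \<le> (1 - real CARD('m) * \<delta> / real (Suc n)) * l1 (p n - stationary G)"
      by simp
  qed (use \<delta> in \<open>auto simp: l1_nonneg\<close>)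
qed

text \<open>The growth of \<open>D\<close> is bounded by sums of the \<open>\<epsilon> k\<close>,
  whose averages tend to 0.\<close>

lemma cesaro_bound_tendsto_0:
  fixes D \<epsilon> :: "nat \<Rightarrow> real"
  assumes nn: "\<And>n. 0 \<le> D n" and le: "\<And>n. n \<ge> 1 \<Longrightarrow> D (Suc n) \<le> D n + \<epsilon> n" and \<epsilon>: "\<epsilon> \<longlonglongrightarrow> 0"
  shows "(\<lambda>n. D n / real n) \<longlonglongrightarrow> 0"
proof (rule tendstoI)
  fix e :: real assume e: "e > 0"
  obtain N0 where N0: "\<And>n. n \<ge> N0 \<Longrightarrow> \<bar>\<epsilon> n\<bar> < e / 2"
    using LIMSEQ_D[OF \<epsilon>, of "e / 2"] e by auto
  define N where "N = max 1 N0"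
  have D: "D n \<le> D N + e / 2 * real (n - N)" if "n \<ge> N" for n
    using that
  proof (induction n rule: dec_induct)
    case (step n)
    then have "D (Suc n) \<le> D n + e / 2" using le[of n] N0[of n] by (auto simp: N_def)
    also have "\<dots> \<le> D N + e / 2 * real (n - N) + e / 2" using step by simp
    also have "\<dots> = D N + e / 2 * real (Suc n - N)" using step by (simp add: Suc_diff_le distrib_left)
    finally show ?case .
  qed simp
  have "(\<lambda>n. D N / real n) \<longlonglongrightarrow> 0" by (rule lim_const_over_n)
  then have "\<forall>\<^sub>F n in sequentially. D N / real n < e / 2" using e by (intro order_tendstoD(2)) auto
  then show "\<forall>\<^sub>F n in sequentially. dist (D n / real n) 0 < e"
    using eventually_ge_at_top[of N]
  proof eventually_elim
    fix n assume n: "D N / real n < e / 2" "n \<ge> N"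
    then have "n > 0" by (simp add: N_def)
    have "e / 2 * real (n - N) \<le> e / 2 * real n" using e by (intro mult_left_mono) auto
    then have "D n \<le> D N + e / 2 * real n" using D[OF n(2)] by linarith
    then have "D n / real n \<le> D N / real n + e / 2" using \<open>n > 0\<close> by (simp add: field_simps)
    then have "D n / real n < e" using n(1) by linarith
    then show "dist (D n / real n) 0 < e" using nn[of n] by (simp add: dist_real_def)
  qed
qed

text \<open>Since the transition matrices do not increase \<open>l1\<close> and \<open>(n / (n + 1)) ^ g \<le> n / (n + 1)\<close>, the
  quantity \<open>n * l1 (f n - a)\<close> has increments bounded by a null sequence, where \<open>a\<close> is the fixed point of the limiting
  equation \<open>g a - a G = c0\<close>.\<close>

lemma moment_recursion_tendsto:
  fixes G :: "real^'m^'m"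
  assumes G: "G \<in> generators" and g: "g \<ge> 1"
    and f: "\<And>n. n \<ge> 1 \<Longrightarrow> f (Suc n) = (real n / real (Suc n)) ^ g *\<^sub>R (f n v* transition G 1 (Suc n))
              + (1 / real (Suc n)) *\<^sub>R c n"
    and c: "c \<longlonglongrightarrow> c0"
  shows "f \<longlonglongrightarrow> c0 v* resolvent G (real g)"
proof (rule tendsto_l1_imp_tendsto)
  define a where "a = c0 v* resolvent G (real g)"
  define r where "r n = real n / real (Suc n)" for n
  define T where "T n = transition G 1 (Suc n)" for n
  \<comment> \<open>The defect of the constant sequence \<open>a\<close> in the recursion, magnified
    by \<open>n + 1\<close>. It tends to \<open>- g a + a G + c0 = 0\<close>.\<close>
  define e where "e n = real (Suc n) *\<^sub>R (r n ^ g *\<^sub>R (a v* T n) - a) + c n" for n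
  have "a v* (mat (real g) - G) = c0"
    using g by (simp add: a_def vector_matrix_mul_assoc resolvent_left_inverse[OF G])
  moreover have "a v* mat (real g) = real g *\<^sub>R a"
    by (simp add: vector_matrix_mult_def mat_def vec_eq_iff if_distrib[of "\<lambda>x. _ * x"] cong: if_cong)
  ultimately have ac: "real g *\<^sub>R a - a v* G = c0"
    by (simp add: vector_matrix_mult_diff_rdistrib)
  have r1: "r \<longlonglongrightarrow> 1" unfolding r_def[abs_def] by (rule LIMSEQ_n_over_Suc_n)
  have rg: "(\<lambda>n. real (Suc n) * (r n ^ g - 1)) \<longlonglongrightarrow> - real g"
  proof -
    have "real (Suc n) * (r n ^ g - 1) = - (\<Sum>k<g. r n ^ k)" for n
    proof -
      have "real (Suc n) * (r n ^ g - 1) = real (Suc n) * (r n - 1) * (\<Sum>k<g. r n ^ k)"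
        by (simp add: power_diff_1_eq mult.assoc)
      also have "real (Suc n) * (r n - 1) = -1" by (simp add: r_def field_simps)
      finally show ?thesis by simp
    qed
    moreover have "(\<lambda>n. - (\<Sum>k<g. r n ^ k)) \<longlonglongrightarrow> - (\<Sum>k<g. 1 ^ k)"
      by (intro tendsto_intros r1)
    ultimately show ?thesis by simp
  qed
  have "(\<lambda>n. (real (Suc n) * (r n ^ g - 1)) *\<^sub>R a + r n ^ g *\<^sub>R (a v* G) + c n)
     \<longlonglongrightarrow> (- real g) *\<^sub>R a + 1 ^ g *\<^sub>R (a v* G) + c0"
    by (intro tendsto_intros rg r1 c)
  also have "(- real g) *\<^sub>R a + 1 ^ g *\<^sub>R (a v* G) + c0 = 0" by (simp flip: ac)
  finally have "e \<longlonglongrightarrow> 0"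
  proof (rule Lim_transform_eventually)
    show "\<forall>\<^sub>F n in sequentially. (real (Suc n) * (r n ^ g - 1)) *\<^sub>R a + r n ^ g *\<^sub>R (a v* G) + c n = e n"
      using eventually_transition_eq[of G]
    proof eventually_elim
      case (elim n)
      then have "a v* T n = a + (1 / real (Suc n)) *\<^sub>R (a v* G)"
        by (simp add: T_def vector_matrix_mult_add_rdistrib vector_scaleR_matrix_ac)
      \<comment> \<open>Used in each coordinate with \<open>s = n + 1\<close> and
        \<open>R = r n ^ g\<close>: the diverging factor \<open>s\<close> then meets only
        \<open>R - 1\<close>, and that product converges.\<close>
      moreover have "s * (R * (x + y / s) - x) = s * (R - 1) * x + R * y" if "s \<noteq> 0" for s R x y :: real
        using that by (simp add: field_simps)
      ultimately show ?case unfolding e_def vec_eq_iff by simp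
    qed
  qed
  then have e0: "(\<lambda>n. l1 (e n)) \<longlonglongrightarrow> 0" using tendsto_l1[of e 0 sequentially] by simp
  have "(\<lambda>n. real n * l1 (f n - a) / real n) \<longlonglongrightarrow> 0"
  proof (rule cesaro_bound_tendsto_0[OF _ _ e0])
    fix n :: nat assume n: "n \<ge> 1"
    have "f (Suc n) - a = r n ^ g *\<^sub>R ((f n - a) v* T n) + (1 / real (Suc n)) *\<^sub>R e n"
      using f[OF n] by (simp add: e_def r_def T_def vector_matrix_mult_diff_distrib scaleR_diff_right scaleR_add_right)
    then have "l1 (f (Suc n) - a) \<le> r n ^ g * l1 ((f n - a) v* T n) + 1 / real (Suc n) * l1 (e n)"
      using l1_add[of "r n ^ g *\<^sub>R ((f n - a) v* T n)" "(1 / real (Suc n)) *\<^sub>R e n"]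
      by (simp add: l1_scaleR r_def)
    also have "r n ^ g * l1 ((f n - a) v* T n) \<le> r n * l1 (f n - a)"
    proof (rule mult_mono)
      show "r n ^ g \<le> r n" using power_decreasing[OF g, of "r n"] by (simp add: r_def)
      show "l1 ((f n - a) v* T n) \<le> l1 (f n - a)" unfolding T_def by (rule transition_l1_le[OF G])
    qed (auto simp: r_def l1_nonneg)
    finally have "real (Suc n) * l1 (f (Suc n) - a) \<le> real (Suc n) * (r n * l1 (f n - a) + 1 / real (Suc n) * l1 (e n))"
      by (intro mult_left_mono) auto
    also have "\<dots> = real n * l1 (f n - a) + l1 (e n)"
      by (simp add: r_def distrib_left)
    finally show "real (Suc n) * l1 (f (Suc n) - a) \<le> real n * l1 (f n - a) + l1 (e n)" .
  qed (simp add: l1_nonneg)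
  then show "(\<lambda>n. l1 (f n - c0 v* resolvent G (real g))) \<longlonglongrightarrow> 0"
    unfolding a_def[symmetric]
    by (rule Lim_transform_eventually) (rule eventually_mono[OF eventually_gt_at_top[of 0]], simp)
qed

section \<open>Moments of the visit counts\<close>

abbreviation cylinder :: "nat \<Rightarrow> (nat \<Rightarrow> 'm) \<Rightarrow> (nat \<Rightarrow> 'm) set" where
  "cylinder n x \<equiv> {\<omega>. \<forall>k\<le>n. \<omega> k = x k}"

text \<open>Measurability with respect to the states up to time \<open>n\<close>, stated pointwise:
  on a finite state space such a real function is a finite combination of cylinder
  indicators.\<close>

definition depends_upto :: "nat \<Rightarrow> ((nat \<Rightarrow> 'm) \<Rightarrow> 'b) \<Rightarrow> bool" where
  "depends_upto n h \<longleftrightarrow> (\<forall>\<omega> \<omega>'. (\<forall>k\<le>n. \<omega> k = \<omega>' k) \<longrightarrow> h \<omega> = h \<omega>')"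

lemma depends_uptoD: "depends_upto n h \<Longrightarrow> (\<And>k. k \<le> n \<Longrightarrow> \<omega> k = \<omega>' k) \<Longrightarrow> h \<omega> = h \<omega>'"
  by (simp add: depends_upto_def)

lemma depends_upto_mono: "depends_upto n h \<Longrightarrow> n \<le> n' \<Longrightarrow> depends_upto n' h"
  unfolding depends_upto_def using order_trans by blast

lemma depends_upto_state: "k \<le> n \<Longrightarrow> depends_upto n (\<lambda>\<omega>. f (\<omega> k))"
  and depends_upto_mult: "depends_upto n h1 \<Longrightarrow> depends_upto n h2 \<Longrightarrow> depends_upto n (\<lambda>\<omega>. h1 \<omega> * h2 \<omega> :: real)"
  by (simp_all add: depends_upto_def) metis+

text \<open>The histories in \<open>PiE {..n}\<close> are \<open>undefined\<close> after time
  \<open>n\<close>, so they form a finite set with exactly one representative of each initial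
  segment.\<close>

lemma finite_horizon_expansion:
  fixes h :: "(nat \<Rightarrow> 'm::finite) \<Rightarrow> real"
  assumes h: "depends_upto n h"
  shows "h \<omega> = (\<Sum>x\<in>PiE {..n} (\<lambda>_. UNIV). h x * indicator (cylinder n x) \<omega>)"
proof -
  let ?r = "restrict \<omega> {..n}"
  have "(\<Sum>x\<in>PiE {..n} (\<lambda>_. UNIV). h x * indicator (cylinder n x) \<omega>)
      = (\<Sum>x\<in>PiE {..n} (\<lambda>_. UNIV). if x = ?r then h ?r else 0)"
  proof (rule sum.cong[OF refl])
    fix x :: "nat \<Rightarrow> 'm" assume x: "x \<in> PiE {..n} (\<lambda>_. UNIV)"
    have "\<omega> \<in> cylinder n x \<longleftrightarrow> x = ?r"
    proof
      assume *: "\<omega> \<in> cylinder n x"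
      show "x = ?r"
        by (rule PiE_ext[OF x, of ?r]) (use * in auto)
    qed auto
    then show "h x * indicator (cylinder n x) \<omega> = (if x = ?r then h ?r else 0)" by simp
  qed
  also have "\<dots> = h ?r" by (subst sum.delta) (auto intro: finite_PiE)
  also have "\<dots> = h \<omega>" by (rule depends_uptoD[OF h]) auto
  finally show ?thesis ..
qed

lemma cylinder_in_chain_sets:
  fixes x :: "nat \<Rightarrow> 'm::finite"
  assumes "is_chain_law (G :: real^'m^'m) \<zeta> \<pi> M"
  shows "cylinder n x \<in> sets M"
  using cylinder_in_sets[of "Suc n" x] assms by (simp add: is_chain_law_def less_Suc_eq_le)

lemma integrable_finite_horizon:
  fixes G :: "real^'m^'m" and h :: "(nat \<Rightarrow> 'm) \<Rightarrow> real"
  assumes M: "is_chain_law G \<zeta> \<pi> M" and h: "depends_upto n h"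
  shows "integrable M h"
proof -
  interpret prob_space M using M by (simp add: is_chain_law_def)
  have "integrable M (\<lambda>\<omega>. \<Sum>x\<in>PiE {..n} (\<lambda>_. UNIV). h x * indicator (cylinder n x) \<omega>)"
    using cylinder_in_chain_sets[OF M] by (auto simp: less_top[symmetric])
  then show ?thesis
    by (rule Bochner_Integration.integrable_cong[OF refl finite_horizon_expansion[OF h], THEN iffD2])
qed

lemma integral_finite_horizon:
  fixes G :: "real^'m^'m" and h :: "(nat \<Rightarrow> 'm) \<Rightarrow> real"
  assumes M: "is_chain_law G \<zeta> \<pi> M" and h: "depends_upto n h"
  shows "(\<integral>\<omega>. h \<omega> \<partial>M) = (\<Sum>x\<in>PiE {..n} (\<lambda>_. UNIV). h x * measure M (cylinder n x))"
proof -
  interpret prob_space M using M by (simp add: is_chain_law_def)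
  have "(\<integral>\<omega>. h \<omega> \<partial>M) = (\<integral>\<omega>. (\<Sum>x\<in>PiE {..n} (\<lambda>_. UNIV). h x * indicator (cylinder n x) \<omega>) \<partial>M)"
    by (rule Bochner_Integration.integral_cong[OF refl finite_horizon_expansion[OF h]])
  also have "\<dots> = (\<Sum>x\<in>PiE {..n} (\<lambda>_. UNIV). h x * measure M (cylinder n x))"
    using cylinder_in_chain_sets[OF M] by (subst Bochner_Integration.integral_sum) (auto simp: less_top[symmetric])
  finally show ?thesis .
qed

text \<open>The Markov property in integrated form. Lengthening a cylinder by the letter
  \<open>j\<close> multiplies its probability by one matrix entry. By the product formula this holds
  for histories of probability 0 too, so nothing has to be conditioned.\<close>

lemma integral_next_state:
  fixes G :: "real^'m^'m" and h :: "(nat \<Rightarrow> 'm) \<Rightarrow> real"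
  assumes M: "is_chain_law G \<zeta> \<pi> M" and h: "depends_upto n h"
  shows "(\<integral>\<omega>. h \<omega> * indicator {j} (\<omega> (Suc n)) \<partial>M)
       = (\<Sum>l\<in>UNIV. (\<integral>\<omega>. h \<omega> * indicator {l} (\<omega> n) \<partial>M) * transition G \<zeta> (Suc n) $ l $ j)"
proof -
  interpret prob_space M using M by (simp add: is_chain_law_def)
  let ?X = "PiE {..n} (\<lambda>_. UNIV) :: (nat \<Rightarrow> 'm) set" and ?T = "transition G \<zeta> (Suc n)"
  have "h \<omega> * indicator {j} (\<omega> (Suc n)) = (\<Sum>x\<in>?X. h x * indicator (cylinder (Suc n) (x(Suc n := j))) \<omega>)" for \<omega>
  proof -
    have "indicator (cylinder (Suc n) (x(Suc n := j))) \<omega> = indicator (cylinder n x) \<omega> * (indicator {j} (\<omega> (Suc n)) :: real)" for x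
      by (auto simp: indicator_def le_Suc_eq)
    then show ?thesis
      unfolding finite_horizon_expansion[OF h, of \<omega>] sum_distrib_right by (simp add: mult.assoc)
  qed
  then have "(\<integral>\<omega>. h \<omega> * indicator {j} (\<omega> (Suc n)) \<partial>M)
      = (\<integral>\<omega>. (\<Sum>x\<in>?X. h x * indicator (cylinder (Suc n) (x(Suc n := j))) \<omega>) \<partial>M)"
    by (rule Bochner_Integration.integral_cong[OF refl])
  also have "\<dots> = (\<Sum>x\<in>?X. h x * measure M (cylinder (Suc n) (x(Suc n := j))))"
    using cylinder_in_chain_sets[OF M] by (subst Bochner_Integration.integral_sum) (auto simp: less_top[symmetric])
  also have "\<dots> = (\<Sum>x\<in>?X. \<Sum>l\<in>UNIV. h x * indicator {l} (x n) * measure M (cylinder n x) * ?T $ l $ j)"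
  proof (rule sum.cong[OF refl])
    fix x :: "nat \<Rightarrow> 'm"
    have law: "measure M (cylinder n x) = pmf \<pi> (x 0) * (\<Prod>k<n. transition G \<zeta> (Suc k) $ x k $ x (Suc k))" for n x
      using M unfolding is_chain_law_iff by blast
    have "(\<Prod>k<n. transition G \<zeta> (Suc k) $ (x(Suc n := j)) k $ (x(Suc n := j)) (Suc k))
        = (\<Prod>k<n. transition G \<zeta> (Suc k) $ x k $ x (Suc k))"
      by (rule prod.cong) auto
    then have "measure M (cylinder (Suc n) (x(Suc n := j))) = measure M (cylinder n x) * ?T $ (x n) $ j"
      unfolding law by simp
    also have "?T $ (x n) $ j = (\<Sum>l\<in>UNIV. indicator {l} (x n) * ?T $ l $ j)"
      by (simp add: indicator_def if_distrib[of "\<lambda>a. a * _"] cong: if_cong)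
    finally have e: "measure M (cylinder (Suc n) (x(Suc n := j)))
        = measure M (cylinder n x) * (\<Sum>l\<in>UNIV. indicator {l} (x n) * ?T $ l $ j)" .
    show "h x * measure M (cylinder (Suc n) (x(Suc n := j)))
        = (\<Sum>l\<in>UNIV. h x * indicator {l} (x n) * measure M (cylinder n x) * ?T $ l $ j)"
      unfolding e by (simp only: sum_distrib_left mult_ac)
  qed
  also have "\<dots> = (\<Sum>l\<in>UNIV. (\<Sum>x\<in>?X. h x * indicator {l} (x n) * measure M (cylinder n x)) * ?T $ l $ j)"
    by (subst sum.swap) (simp add: sum_distrib_right)
  also have "\<dots> = (\<Sum>l\<in>UNIV. (\<integral>\<omega>. h \<omega> * indicator {l} (\<omega> n) \<partial>M) * ?T $ l $ j)"
    by (subst integral_finite_horizon[OF M depends_upto_mult[OF h depends_upto_state]]) auto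
  finally show ?thesis .
qed

section \<open>Visit counts and binomial moments\<close>

definition visits :: "nat \<Rightarrow> (nat \<Rightarrow> 'm) \<Rightarrow> 'm \<Rightarrow> nat" where
  "visits n \<omega> i = card {k \<in> {1..n}. \<omega> k = i}"

lemma visits_Suc: "visits (Suc n) \<omega> i = visits n \<omega> i + (if i = \<omega> (Suc n) then 1 else 0)"
proof -
  have "{k \<in> {1..Suc n}. \<omega> k = i} = {k \<in> {1..n}. \<omega> k = i} \<union> (if i = \<omega> (Suc n) then {Suc n} else {})"
    by (auto simp: le_Suc_eq)
  then show ?thesis by (auto simp: visits_def)
qed

lemma depends_upto_visits:
  fixes f :: "('m \<Rightarrow> nat) \<Rightarrow> 'b"
  shows "depends_upto n (\<lambda>\<omega>. f (visits n \<omega>))"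
proof -
  have "visits n \<omega> = visits n \<omega>'" if "\<forall>k\<le>n. \<omega> k = \<omega>' k" for \<omega> \<omega>' :: "nat \<Rightarrow> 'm"
    using that unfolding visits_def by (intro ext arg_cong[where f=card]) auto
  then show ?thesis unfolding depends_upto_def by (intro allI impI arg_cong[where f=f])
qed

lemma occupation_eq_visits: "occupation n \<omega> $ i = real (visits n \<omega> i) / real n"
proof -
  have "(\<Sum>k=1..n. indicator {i} (\<omega> k)) = real (visits n \<omega> i)"
    by (induction n) (auto simp: visits_Suc, simp add: visits_def)
  then show ?thesis by (simp add: occupation_def)
qed

lemma sum_visits: "(\<Sum>i\<in>UNIV. visits n \<omega> (i :: 'm::finite)) = n"
proof (induction n)
  case (Suc n)
  then show ?case by (simp add: visits_Suc sum.distrib)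
qed (simp add: visits_def)

lemma visits_le: "visits n \<omega> i \<le> n"
proof -
  have "visits n \<omega> i \<le> card {1..n}" unfolding visits_def by (rule card_mono) auto
  then show ?thesis by simp
qed

text \<open>The number of ways to select, for every state \<open>i\<close>, \<open>count A i\<close>
  out of its \<open>v i\<close> visits.\<close>

definition multi_choose :: "('m::finite \<Rightarrow> nat) \<Rightarrow> 'm multiset \<Rightarrow> real" where
  "multi_choose v A = (\<Prod>i\<in>UNIV. real (v i choose count A i))"

lemma multi_choose_empty [simp]: "multi_choose v {#} = 1"
  by (simp add: multi_choose_def)

text \<open>The additional visit to \<open>j\<close> is either left out or selected; in the latter
  case \<open>A - {#j#}\<close> remains to be selected among the old visits.\<close>

lemma multi_choose_pascal:
  "multi_choose (\<lambda>i. v i + (if i = j then 1 else 0)) A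
   = multi_choose v A + (if j \<in># A then multi_choose v (A - {#j#}) else 0)"
proof -
  have 1: "multi_choose (\<lambda>i. v i + (if i = j then 1 else 0)) A
      = real (Suc (v j) choose count A j) * (\<Prod>i\<in>UNIV-{j}. real (v i choose count A i))"
    unfolding multi_choose_def by (subst prod.remove[of UNIV j]) auto
  have 2: "multi_choose v A = real (v j choose count A j) * (\<Prod>i\<in>UNIV-{j}. real (v i choose count A i))"
    unfolding multi_choose_def by (subst prod.remove[of UNIV j]) auto
  have 3: "multi_choose v (A - {#j#}) = real (v j choose (count A j - 1)) * (\<Prod>i\<in>UNIV-{j}. real (v i choose count A i))"
    unfolding multi_choose_def by (subst prod.remove[of UNIV j]) auto
  show ?thesis
  proof (cases "count A j")
    case 0
    then have "j \<notin># A" by (simp add: not_in_iff)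
    then show ?thesis unfolding 1 2 using 0 by simp
  next
    case (Suc k)
    then have "j \<in># A" by (metis count_eq_zero_iff nat.distinct(1))
    then show ?thesis unfolding 1 2 3 using Suc by (simp add: algebra_simps)
  qed
qed

text \<open>Binomial moments are used instead of power moments because Pascal's rule makes their recursion
  exact.\<close>

definition binomial_moment :: "(nat \<Rightarrow> 'm) measure \<Rightarrow> 'm multiset \<Rightarrow> nat \<Rightarrow> real^'m" where
  "binomial_moment M A n = (\<chi> j. \<integral>\<omega>. multi_choose (visits n \<omega>) A * indicator {j} (\<omega> n) \<partial>M)"

text \<open>The state recorded at time \<open>n + 1\<close> is also the new visit, so
  \<open>A - {#j#}\<close> enters only coordinate \<open>j\<close>. All source terms thus have
  smaller multisets, which permits induction on the size.\<close>

lemma binomial_moment_Suc: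
  fixes G :: "real^'m^'m"
  assumes M: "is_chain_law G \<zeta> \<pi> M"
  shows "binomial_moment M A (Suc n) = binomial_moment M A n v* transition G \<zeta> (Suc n)
     + (\<chi> j. if j \<in># A then (binomial_moment M (A - {#j#}) n v* transition G \<zeta> (Suc n)) $ j else 0)"
proof -
  note dep = depends_upto_visits[of n "\<lambda>v. multi_choose v A" for A]
  have step: "(\<integral>\<omega>. multi_choose (visits n \<omega>) A * indicator {j} (\<omega> (Suc n)) \<partial>M)
      = (binomial_moment M A n v* transition G \<zeta> (Suc n)) $ j" for A j
    unfolding integral_next_state[OF M dep] by (simp add: vector_matrix_mult_def binomial_moment_def)
  have int: "integrable M (\<lambda>\<omega>. multi_choose (visits n \<omega>) A * indicator {j} (\<omega> (Suc n)))" for A j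
    by (rule integrable_finite_horizon[OF M depends_upto_mult[OF depends_upto_mono[OF dep] depends_upto_state, of "Suc n" "Suc n"]]) auto
  have "binomial_moment M A (Suc n) $ j = (binomial_moment M A n v* transition G \<zeta> (Suc n)) $ j
      + (if j \<in># A then (binomial_moment M (A - {#j#}) n v* transition G \<zeta> (Suc n)) $ j else 0)" for j
  proof -
    have "multi_choose (visits (Suc n) \<omega>) A * indicator {j} (\<omega> (Suc n))
        = multi_choose (visits n \<omega>) A * indicator {j} (\<omega> (Suc n))
          + (if j \<in># A then multi_choose (visits n \<omega>) (A - {#j#}) * indicator {j} (\<omega> (Suc n)) else 0)" for \<omega>
    proof -
      have "visits (Suc n) \<omega> = (\<lambda>i. visits n \<omega> i + (if i = \<omega> (Suc n) then 1 else 0))"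
        by (rule ext) (rule visits_Suc)
      then show ?thesis by (simp add: multi_choose_pascal indicator_def)
    qed
    then show ?thesis using int by (auto simp: binomial_moment_def step)
  qed
  then show ?thesis by (simp add: vec_eq_iff)
qed

lemma sum_binomial_moment:
  fixes G :: "real^'m^'m"
  assumes M: "is_chain_law G \<zeta> \<pi> M"
  shows "(\<Sum>j\<in>UNIV. binomial_moment M A n $ j) = (\<integral>\<omega>. multi_choose (visits n \<omega>) A \<partial>M)"
proof -
  note dep = depends_upto_visits[of n "\<lambda>v. multi_choose v A"]
  have "(\<Sum>j\<in>UNIV. binomial_moment M A n $ j)
      = (\<integral>\<omega>. (\<Sum>j\<in>UNIV. multi_choose (visits n \<omega>) A * indicator {j} (\<omega> n)) \<partial>M)"
    unfolding binomial_moment_def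
    by (subst Bochner_Integration.integral_sum)
       (auto intro!: integrable_finite_horizon[OF M depends_upto_mult[OF dep depends_upto_state]])
  also have "\<dots> = (\<integral>\<omega>. multi_choose (visits n \<omega>) A \<partial>M)"
    by (rule Bochner_Integration.integral_cong[OF refl])
       (simp add: indicator_def if_distrib[of "\<lambda>a. _ * a"] cong: if_cong)
  finally show ?thesis .
qed

section \<open>The limiting moments\<close>

text \<open>Words are read in reverse: the head is the last letter in time.\<close>

primrec word_weight :: "real^'m^'m \<Rightarrow> 'm list \<Rightarrow> real^'m" where
  "word_weight G [] = stationary G"
| "word_weight G (i # w) = (\<chi> j. word_weight G w $ i * resolvent G (real (Suc (length w))) $ i $ j)"

text \<open>The candidate limit of the rescaled binomial moments. Each distinct word occurs once;
  multiplicities enter later through the factorials that turn binomial coefficients into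
  powers.\<close>

definition limit_vec :: "real^'m^'m \<Rightarrow> 'm multiset \<Rightarrow> real^'m" where
  "limit_vec G A = (\<Sum>w\<in>permutations_of_multiset A. word_weight G w)"

lemma sum_permutations_of_multiset_head:
  assumes "A \<noteq> {#}"
  shows "(\<Sum>w\<in>permutations_of_multiset A. F w)
       = (\<Sum>i\<in>set_mset A. \<Sum>w\<in>permutations_of_multiset (A - {#i#}). F (i # w))"
  unfolding permutations_of_multiset_nonempty[OF assms]
  by (subst sum.UNION_disjoint) (auto simp: sum.reindex)

lemma sum_set_mset_UNIV:
  fixes A :: "'m::finite multiset"
  shows "(\<Sum>i\<in>set_mset A. f i) = (\<Sum>i\<in>UNIV. if i \<in># A then f i else 0)"
  by (simp add: sum.If_cases)

lemma limit_vec_empty [simp]: "limit_vec G {#} = stationary G"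
  by (simp add: limit_vec_def)

text \<open>Groups the words by their head, the final state in time. The weight \<open>f\<close>
  stays open for two uses: a column of the resolvent gives the recursion, a constant the total
  mass.\<close>

lemma sum_word_weight_tl:
  assumes "A \<noteq> {#}"
  shows "(\<Sum>w\<in>permutations_of_multiset A. word_weight G (tl w) $ hd w * f (hd w))
       = (\<Sum>i\<in>UNIV. (if i \<in># A then limit_vec G (A - {#i#}) $ i else 0) * f i)"
  unfolding sum_permutations_of_multiset_head[OF assms] sum_set_mset_UNIV
  by (rule sum.cong) (auto simp: limit_vec_def sum_distrib_right)

text \<open>The form of the limit in \<open>moment_recursion_tendsto\<close>. All words have length
  \<open>size A\<close>, so they share the last resolvent.\<close>

lemma limit_vec_rec:
  assumes "A \<noteq> {#}"
  shows "limit_vec G A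
    = (\<chi> i. if i \<in># A then limit_vec G (A - {#i#}) $ i else 0) v* resolvent G (real (size A))"
proof -
  have "limit_vec G A $ j = ((\<chi> i. if i \<in># A then limit_vec G (A - {#i#}) $ i else 0) v* resolvent G (real (size A))) $ j" for j
  proof -
    have "limit_vec G A $ j
        = (\<Sum>w\<in>permutations_of_multiset A. word_weight G (tl w) $ hd w * resolvent G (real (size A)) $ hd w $ j)"
      unfolding limit_vec_def sum_component
    proof (rule sum.cong[OF refl])
      fix w assume "w \<in> permutations_of_multiset A"
      then have w: "mset w = A" by (rule permutations_of_multisetD)
      then obtain i w' where "w = i # w'" using assms by (cases w) auto
      with w show "word_weight G w $ j = word_weight G (tl w) $ hd w * resolvent G (real (size A)) $ hd w $ j"
        by auto
    qed
    then show ?thesis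
      by (simp add: sum_word_weight_tl[OF assms, of G "\<lambda>i. resolvent G (real (size A)) $ i $ j"] vector_matrix_mult_def)
  qed
  then show ?thesis by (simp add: vec_eq_iff)
qed

text \<open>Summing out the end state replaces the last resolvent by its row sum. This is the origin
  of the prefactor \<open>1 / g\<close> and of the \<open>g - 1\<close> resolvents for
  \<open>g\<close> letters in the moment formula.\<close>

lemma sum_limit_vec:
  fixes G :: "real^'m^'m"
  assumes G: "G \<in> generators" and A: "A \<noteq> {#}"
  shows "(\<Sum>j\<in>UNIV. limit_vec G A $ j)
    = 1 / real (size A) * (\<Sum>w\<in>permutations_of_multiset A. word_weight G (tl w) $ hd w)"
proof -
  let ?u = "\<chi> i. if i \<in># A then limit_vec G (A - {#i#}) $ i else 0"
  have "size A > 0" using A by (simp add: nonempty_has_size)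
  have "(\<Sum>j\<in>UNIV. limit_vec G A $ j) = (\<Sum>i\<in>UNIV. ?u $ i * (\<Sum>j\<in>UNIV. resolvent G (real (size A)) $ i $ j))"
    unfolding limit_vec_rec[OF A] vector_matrix_mult_def
    by (simp add: sum_distrib_left del: vec_lambda_beta) (simp, rule sum.swap)
  also have "\<dots> = (\<Sum>i\<in>UNIV. ?u $ i * (1 / real (size A)))"
    using resolvent_row_sum[OF G, of "real (size A)"] \<open>size A > 0\<close> by simp
  also have "\<dots> = (\<Sum>w\<in>permutations_of_multiset A. word_weight G (tl w) $ hd w * (1 / real (size A)))"
    unfolding sum_word_weight_tl[OF A, of G "\<lambda>_. 1 / real (size A)"] by simp
  finally show ?thesis by (simp add: sum_divide_distrib)
qed

text \<open>Links the recursive weight to the product over positions: the coordinate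
  \<open>x\<close> acts as last letter of the chronological word \<open>s @ [x]\<close>. Appending
  to \<open>s\<close> is consing onto \<open>rev s\<close>, hence the reverse induction.\<close>

lemma word_weight_rev:
  "word_weight G (rev s) $ x
    = stationary G $ ((s @ [x]) ! 0) * (\<Prod>i=1..length s. resolvent G (real i) $ ((s @ [x]) ! (i - 1)) $ ((s @ [x]) ! i))"
proof (induction s arbitrary: x rule: rev_induct)
  case (snoc y s)
  let ?n = "length s"
  have "(\<Prod>i=1..Suc ?n. resolvent G (real i) $ ((s @ [y, x]) ! (i - 1)) $ ((s @ [y, x]) ! i))
      = (\<Prod>i=1..?n. resolvent G (real i) $ ((s @ [y, x]) ! (i - 1)) $ ((s @ [y, x]) ! i)) * resolvent G (real (Suc ?n)) $ y $ x"
    by (simp add: nth_append)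
  also have "(\<Prod>i=1..?n. resolvent G (real i) $ ((s @ [y, x]) ! (i - 1)) $ ((s @ [y, x]) ! i))
      = (\<Prod>i=1..?n. resolvent G (real i) $ ((s @ [y]) ! (i - 1)) $ ((s @ [y]) ! i))"
    by (rule prod.cong) (auto simp: nth_append)
  finally have "(\<Prod>i=1..Suc ?n. resolvent G (real i) $ ((s @ [y, x]) ! (i - 1)) $ ((s @ [y, x]) ! i))
      = (\<Prod>i=1..?n. resolvent G (real i) $ ((s @ [y]) ! (i - 1)) $ ((s @ [y]) ! i)) * resolvent G (real (Suc ?n)) $ y $ x" .
  moreover have "(s @ [y, x]) ! 0 = (s @ [y]) ! 0" by (simp add: nth_append)
  moreover have "word_weight G (rev (s @ [y])) $ x = word_weight G (rev s) $ y * resolvent G (real (Suc ?n)) $ y $ x"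
    by simp
  ultimately show ?case unfolding snoc.IH[of y] by simp
qed simp

lemma sum_arrangements:
  fixes A :: "'m::finite multiset"
  shows "(\<Sum>\<sigma>\<in>#arrangements (count A). F \<sigma> :: real)
       = (\<Prod>k\<in>UNIV. fact (count A k)) * (\<Sum>\<sigma>\<in>permutations_of_multiset A. F \<sigma>)"
proof -
  define c where "c = (\<Prod>k\<in>UNIV. fact (count A k) :: nat)"
  have "arrangements (count A) = repeat_mset c (mset_set (permutations_of_multiset A))"
  proof (rule multiset_eqI)
    fix \<sigma>
    have "\<sigma> \<in> permutations_of_multiset A \<longleftrightarrow> (\<forall>k. count (mset \<sigma>) k = count A k)"
      by (auto simp: permutations_of_multiset_def multiset_eq_iff)
    then show "count (arrangements (count A)) \<sigma> = count (repeat_mset c (mset_set (permutations_of_multiset A))) \<sigma>"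
      by (simp add: count_arrangements c_def count_mset_set')
  qed
  moreover have "(\<Sum>\<sigma>\<in>#repeat_mset n N. F \<sigma>) = real n * (\<Sum>\<sigma>\<in>#N. F \<sigma>)" for n and N :: "'m list multiset"
    by (induction n) (auto simp: algebra_simps)
  ultimately show ?thesis by (simp add: c_def sum_unfold_sum_mset)
qed

lemma sum_count: "(\<Sum>k\<in>UNIV. count A k) = size (A :: 'm::finite multiset)"
  unfolding size_multiset_overloaded_eq by (rule sum.mono_neutral_right) (auto simp: not_in_iff)

lemma limit_moment_eq:
  fixes G :: "real^'m^'m"
  assumes G: "G \<in> generators" and A: "A \<noteq> {#}"
  shows "limit_moment G (count A) = (\<Prod>k\<in>UNIV. fact (count A k)) * (\<Sum>j\<in>UNIV. limit_vec G A $ j)"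
proof -
  let ?F = "\<lambda>\<sigma>. stationary G $ (\<sigma> ! 0) * (\<Prod>i=1..size A - 1. resolvent G (real i) $ (\<sigma> ! (i - 1)) $ (\<sigma> ! i))"
  \<comment> \<open>The arrangements of a multiset are closed under reversal, so chronological words
    can be traded for reversed ones.\<close>
  have "(\<Sum>\<sigma>\<in>permutations_of_multiset A. ?F \<sigma>)
      = (\<Sum>w\<in>rev ` permutations_of_multiset A. word_weight G (tl w) $ hd w)"
  proof (subst sum.reindex)
    show "sum ?F (permutations_of_multiset A) = sum ((\<lambda>w. word_weight G (tl w) $ hd w) \<circ> rev) (permutations_of_multiset A)"
    proof (rule sum.cong[OF refl])
      fix \<sigma> assume "\<sigma> \<in> permutations_of_multiset A"
      then have m: "mset \<sigma> = A" by (rule permutations_of_multisetD)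
      then obtain s x where "\<sigma> = s @ [x]" using A by (cases \<sigma> rule: rev_cases) auto
      moreover have "size A = length \<sigma>" using m by auto
      ultimately show "?F \<sigma> = ((\<lambda>w. word_weight G (tl w) $ hd w) \<circ> rev) \<sigma>"
        using word_weight_rev[of G s x] by simp
    qed
  qed (auto simp: inj_on_def)
  then show ?thesis
    unfolding limit_moment_def Let_def sum_count sum_arrangements sum_limit_vec[OF G A] by simp
qed

section \<open>Convergence of binomial and power moments\<close>

lemma binomial_moment_tendsto:
  fixes G :: "real^'m^'m"
  assumes G: "G \<in> generators" and M: "is_chain_law G 1 \<pi> M"
  shows "(\<lambda>n. (1 / real n ^ size A) *\<^sub>R binomial_moment M A n) \<longlonglongrightarrow> limit_vec G A"
proof (induction "size A" arbitrary: A rule: less_induct)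
  case less
  interpret prob_space M using M by (simp add: is_chain_law_def)
  show ?case
  proof (cases "A = {#}")
    case True
    \<comment> \<open>With nothing selected, the binomial moment is the law of
      \<open>X\<^sub>n\<close>.\<close>
    have "binomial_moment M {#} \<longlonglongrightarrow> stationary G"
    proof (rule law_tendsto_stationary[OF G])
      show "binomial_moment M {#} (Suc n) = binomial_moment M {#} n v* transition G 1 (Suc n)" for n
        unfolding binomial_moment_Suc[OF M] by (simp add: vec_eq_iff)
      show "(\<Sum>i\<in>UNIV. binomial_moment M {#} n $ i) = 1" for n
        by (simp add: sum_binomial_moment[OF M] prob_space)
    qed
    then show ?thesis using True by simp
  next
    case False
    define g where "g = size A"
    have g: "g \<ge> 1" using False by (simp add: g_def Suc_le_eq nonempty_has_size)
    define f where "f B n = (1 / real n ^ size B) *\<^sub>R binomial_moment M B n" for B n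
    \<comment> \<open>The smaller moments are scaled by \<open>n ^ (g - 1)\<close> but get divided
      by \<open>(n + 1) ^ g\<close>; the quotient leaves this power of \<open>n / (n + 1)\<close>
      and the factor \<open>1 / (n + 1)\<close> of the recursion.\<close>
    define c where "c n = (\<chi> j. if j \<in># A
      then (real n / real (Suc n)) ^ (g - 1) * (f (A - {#j#}) n v* transition G 1 (Suc n)) $ j else 0)" for n
    have "c \<longlonglongrightarrow> (\<chi> j. if j \<in># A then limit_vec G (A - {#j#}) $ j else 0)"
    proof (rule vec_tendstoI)
      fix j
      have "(\<lambda>n. (real n / real (Suc n)) ^ (g - 1) * (f (A - {#j#}) n v* transition G 1 (Suc n)) $ j)
          \<longlonglongrightarrow> 1 ^ (g - 1) * (limit_vec G (A - {#j#}) v* mat 1) $ j" if "j \<in># A"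
      proof -
        have "f (A - {#j#}) \<longlonglongrightarrow> limit_vec G (A - {#j#})"
          unfolding f_def by (rule less) (rule size_Diff1_less[OF that])
        then show ?thesis
          by (intro tendsto_intros LIMSEQ_n_over_Suc_n transition_tendsto)
      qed
      then show "(\<lambda>n. c n $ j) \<longlonglongrightarrow> (\<chi> j. if j \<in># A then limit_vec G (A - {#j#}) $ j else 0) $ j"
        by (cases "j \<in># A") (auto simp: c_def)
    qed
    moreover have "f A (Suc n) = (real n / real (Suc n)) ^ g *\<^sub>R (f A n v* transition G 1 (Suc n)) + (1 / real (Suc n)) *\<^sub>R c n"
      if n: "n \<ge> 1" for n
    proof -
      define T where "T = transition G 1 (Suc n)"
      have f: "(f B n v* T) $ j = (binomial_moment M B n v* T) $ j / real n ^ size B" for B j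
        by (simp add: f_def scaleR_vector_matrix_assoc)
      have c: "c n $ j = (if j \<in># A then (real n / real (Suc n)) ^ (g - 1) * ((binomial_moment M (A - {#j#}) n v* T) $ j / real n ^ (g - 1)) else 0)" for j
        by (simp add: c_def f T_def[symmetric] size_Diff_singleton g_def)
      have "f A (Suc n) $ j = (real n / real (Suc n)) ^ g * (f A n v* T) $ j + (1 / real (Suc n)) * c n $ j" for j
      proof -
        have "real (Suc n) ^ g = real (Suc n) ^ (g - 1) * real (Suc n)"
          using g by (metis power_minus_mult Suc_le_lessD One_nat_def)
        then show ?thesis
          unfolding c f using n
          by (simp add: f_def binomial_moment_Suc[OF M] T_def[symmetric] g_def[symmetric] power_divide add_divide_distrib)
      qed
      then show ?thesis by (simp add: vec_eq_iff T_def)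
    qed
    ultimately have "f A \<longlonglongrightarrow> (\<chi> j. if j \<in># A then limit_vec G (A - {#j#}) $ j else 0) v* resolvent G (real g)"
      by (intro moment_recursion_tendsto[OF G g])
    then show ?thesis unfolding f_def limit_vec_rec[OF False] g_def .
  qed
qed

lemma fact_mult_choose: "fact k * real (n choose k) = (\<Prod>r<k. real n - real r)"
proof -
  have "real (n choose k) = (\<Prod>i = 0..<k. real n - of_nat i) / fact k"
    by (simp add: binomial_gbinomial gbinomial_prod_rev)
  then show ?thesis by (simp add: atLeast0LessThan)
qed

text \<open>Both terms are products of \<open>size A\<close> factors, \<open>v i / n\<close> against
  \<open>(v i - r) / n\<close> from the falling factorial. As \<open>size A \<le> n\<close>, all
  factors lie in \<open>[-1, 1]\<close>, so the products differ at most by the sum of the factor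
  differences \<open>r / n\<close>. The bound is uniform in \<open>v\<close> and therefore survives
  integration.\<close>

lemma monomial_multi_choose_diff:
  fixes A :: "'m::finite multiset"
  assumes v: "\<And>i. v i \<le> n" and n: "size A \<le> n" "n > 0"
  shows "\<bar>(\<Prod>i\<in>UNIV. (real (v i) / real n) ^ count A i)
     - (\<Prod>i\<in>UNIV. fact (count A i)) * (multi_choose v A / real n ^ size A)\<bar>
     \<le> (\<Sum>i\<in>UNIV. \<Sum>r<count A i. real r) / real n"
proof -
  define z where "z i = real (v i) / real n" for i
  have z: "0 \<le> z i" "z i \<le> 1" for i using v[of i] n by (auto simp: z_def)
  have factor: "\<bar>z i - real r / real n\<bar> \<le> 1" if "r < count A i" for i r
  proof -
    have "count A i \<le> size A" by (rule count_le_size)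
    then have "real r / real n \<le> 1" using that n by simp
    moreover have "0 \<le> real r / real n" by simp
    ultimately show ?thesis using z[of i] by linarith
  qed
  have "(\<Prod>i\<in>UNIV. fact (count A i)) * (multi_choose v A / real n ^ size A)
      = (\<Prod>i\<in>UNIV. \<Prod>r<count A i. z i - real r / real n)"
  proof -
    have "(\<Prod>r<count A i. z i - real r / real n) = fact (count A i) * real (v i choose count A i) / real n ^ count A i" for i
      unfolding fact_mult_choose z_def using n by (simp add: diff_divide_distrib[symmetric] prod_dividef)
    then show ?thesis
      by (simp add: multi_choose_def prod.distrib prod_dividef sum_count[symmetric] power_sum)
  qed
  then have "\<bar>(\<Prod>i\<in>UNIV. z i ^ count A i) - (\<Prod>i\<in>UNIV. fact (count A i)) * (multi_choose v A / real n ^ size A)\<bar>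
      = norm ((\<Prod>i\<in>UNIV. \<Prod>r<count A i. z i) - (\<Prod>i\<in>UNIV. \<Prod>r<count A i. z i - real r / real n))"
    by simp
  also have "\<dots> \<le> (\<Sum>i\<in>UNIV. norm ((\<Prod>r<count A i. z i) - (\<Prod>r<count A i. z i - real r / real n)))"
    using z factor by (intro norm_prod_diff) (auto simp: power_le_one abs_prod intro!: prod_le_1)
  also have "\<dots> \<le> (\<Sum>i\<in>UNIV. \<Sum>r<count A i. norm (z i - (z i - real r / real n)))"
    using z factor by (intro sum_mono norm_prod_diff) auto
  also have "\<dots> = (\<Sum>i\<in>UNIV. \<Sum>r<count A i. real r) / real n"
    by (simp add: sum_divide_distrib)
  finally show ?thesis unfolding z_def .
qed

theorem occupation_moment_tendsto:
  fixes G :: "real^'m^'m"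
  assumes G: "G \<in> generators" and M: "is_chain_law G 1 \<pi> M"
  shows "(\<lambda>n. \<integral>\<omega>. (\<Prod>k\<in>UNIV. (occupation n \<omega> $ k) ^ count A k) \<partial>M)
    \<longlonglongrightarrow> (\<Prod>k\<in>UNIV. fact (count A k)) * (\<Sum>j\<in>UNIV. limit_vec G A $ j)"
proof -
  interpret prob_space M using M by (simp add: is_chain_law_def)
  let ?c = "\<Prod>k\<in>UNIV. fact (count A k) :: real"
  define R where "R = (\<Sum>i\<in>UNIV. \<Sum>r<count A i. real r)"
  have "(\<lambda>n. ?c * (\<Sum>j\<in>UNIV. ((1 / real n ^ size A) *\<^sub>R binomial_moment M A n) $ j)) \<longlonglongrightarrow> ?c * (\<Sum>j\<in>UNIV. limit_vec G A $ j)"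
    by (intro tendsto_intros binomial_moment_tendsto[OF G M])
  moreover have "(\<lambda>n. (\<integral>\<omega>. (\<Prod>k\<in>UNIV. (occupation n \<omega> $ k) ^ count A k) \<partial>M)
      - ?c * (\<Sum>j\<in>UNIV. ((1 / real n ^ size A) *\<^sub>R binomial_moment M A n) $ j)) \<longlonglongrightarrow> 0"
  proof (rule Lim_null_comparison)
    show "(\<lambda>n. R / real n) \<longlonglongrightarrow> 0" by (rule lim_const_over_n)
    show "\<forall>\<^sub>F n in sequentially. norm ((\<integral>\<omega>. (\<Prod>k\<in>UNIV. (occupation n \<omega> $ k) ^ count A k) \<partial>M)
      - ?c * (\<Sum>j\<in>UNIV. ((1 / real n ^ size A) *\<^sub>R binomial_moment M A n) $ j)) \<le> R / real n"
      using eventually_ge_at_top[of "max 1 (size A)"]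
    proof eventually_elim
      case (elim n)
      let ?p = "\<lambda>\<omega>. \<Prod>k\<in>UNIV. (occupation n \<omega> $ k) ^ count A k"
      let ?q = "\<lambda>\<omega>. ?c * (multi_choose (visits n \<omega>) A / real n ^ size A)"
      have p: "integrable M ?p"
        unfolding occupation_eq_visits
        by (rule integrable_finite_horizon[OF M depends_upto_visits])
      have q: "integrable M ?q"
        by (rule integrable_finite_horizon[OF M depends_upto_visits])
      have "?c * (\<Sum>j\<in>UNIV. ((1 / real n ^ size A) *\<^sub>R binomial_moment M A n) $ j) = (\<integral>\<omega>. ?q \<omega> \<partial>M)"
        by (simp add: sum_divide_distrib[symmetric] sum_binomial_moment[OF M])
      then have "norm ((\<integral>\<omega>. ?p \<omega> \<partial>M) - ?c * (\<Sum>j\<in>UNIV. ((1 / real n ^ size A) *\<^sub>R binomial_moment M A n) $ j))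
         = \<bar>\<integral>\<omega>. ?p \<omega> - ?q \<omega> \<partial>M\<bar>"
        using p q by simp
      also have "\<dots> \<le> (\<integral>\<omega>. \<bar>?p \<omega> - ?q \<omega>\<bar> \<partial>M)" by (rule integral_abs_bound)
      also have "\<dots> \<le> (\<integral>\<omega>. R / real n \<partial>M)"
      proof (rule integral_mono)
        show "\<bar>?p \<omega> - ?q \<omega>\<bar> \<le> R / real n" for \<omega>
          unfolding R_def occupation_eq_visits
          using elim by (intro monomial_multi_choose_diff visits_le) auto
      qed (use p q in auto)
      finally show ?case by (simp add: prob_space)
    qed
  qed
  ultimately show ?thesis by (rule Lim_transform[rotated, rotated]) 
qed

section \<open>Convergence of the occupation vector\<close>

lemma occupation_measurable:
  fixes G :: "real^'m^'m"
  assumes M: "is_chain_law G \<zeta> \<pi> M"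
  shows "occupation n \<in> borel_measurable M"
proof -
  have "(\<lambda>\<omega>. occupation n \<omega> $ i) \<in> borel_measurable M" for i
    unfolding occupation_eq_visits
    by (rule borel_measurable_integrable[OF integrable_finite_horizon[OF M depends_upto_visits]])
  then show ?thesis
    by (subst borel_measurable_euclidean_space) (auto simp: Basis_vec_def inner_axis)
qed

lemma occupation_in_simplex:
  assumes "n \<ge> 1"
  shows "occupation n \<omega> \<in> prob_simplex"
proof -
  have "real (visits n \<omega> i) \<le> real n" for i using visits_le[of n \<omega> i] by simp
  moreover have "(\<Sum>i\<in>UNIV. real (visits n \<omega> i)) = real n" by (metis of_nat_sum sum_visits)
  ultimately show ?thesis
    using assms by (simp add: prob_simplex_def occupation_eq_visits sum_divide_distrib[symmetric])
qed

lemma compact_prob_simplex: "compact (prob_simplex :: (real^'m) set)"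
proof -
  have eq: "prob_simplex = cbox 0 1 \<inter> {x :: real^'m. (\<Sum>i\<in>UNIV. x $ i) = 1}"
    by (auto simp: prob_simplex_def mem_box_cart)
  show ?thesis
    unfolding eq by (intro compact_Int_closed compact_cbox closed_Collect_eq continuous_intros)
qed

text \<open>Covers every size: the empty multiset gets the total mass 1, whereas the prefactor of
  \<open>limit_moment\<close> would be \<open>1 / 0 = 0\<close>.\<close>

definition moment :: "real^'m^'m \<Rightarrow> 'm multiset \<Rightarrow> real" where
  "moment G A = (\<Prod>k\<in>UNIV. fact (count A k)) * (\<Sum>j\<in>UNIV. limit_vec G A $ j)"

lemma moment_empty: "G \<in> generators \<Longrightarrow> moment G {#} = 1"
  by (simp add: moment_def stationary_sum)

lemma moment_singleton: "G \<in> generators \<Longrightarrow> moment G {#i#} = stationary G $ i"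
proof -
  assume "G \<in> generators"
  moreover have "(\<Prod>k\<in>UNIV. fact (count {#i#} k)) = (1 :: real)" by (rule prod.neutral) auto
  ultimately show ?thesis by (simp add: moment_def sum_limit_vec del: count_add_mset)
qed

lemma ex_multiset_count: "\<exists>A. (\<gamma> :: 'm::finite \<Rightarrow> nat) = count A"
  by (rule exI[of _ "Abs_multiset \<gamma>"]) (simp add: count_Abs_multiset)

lemma prod_power_count_singleton: "(\<Prod>k\<in>UNIV. x $ k ^ count {#i#} k) = (x $ i :: real)"
proof -
  have "(\<Prod>k\<in>UNIV. x $ k ^ count {#i#} k) = (\<Prod>k\<in>UNIV. if k = i then x $ k else 1)"
    by (rule prod.cong) auto
  then show ?thesis by simp
qed

text \<open>Merges total mass, means and higher moments into one condition over all multisets, the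
  form in which moments determine the measure.\<close>

lemma has_limit_moments_iff:
  fixes G :: "real^'m^'m"
  assumes G: "G \<in> generators"
  shows "has_limit_moments G \<mu> \<longleftrightarrow> concentrated_on prob_simplex \<mu> \<and>
    (\<forall>A. (\<integral>x. (\<Prod>k\<in>UNIV. x $ k ^ count A k) \<partial>\<mu>) = moment G A)" (is "?L \<longleftrightarrow> ?R")
proof
  assume L: ?L
  then have conc: "concentrated_on prob_simplex \<mu>" by (simp add: has_limit_moments_def concentrated_on_def)
  then interpret prob_space \<mu> by (simp add: concentrated_on_def)
  have "(\<integral>x. (\<Prod>k\<in>UNIV. x $ k ^ count A k) \<partial>\<mu>) = moment G A" for A
  proof -
    consider "size A = 0" | "size A = 1" | "size A \<ge> 2" by linarith
    then show ?thesis
    proof cases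
      case 1
      then show ?thesis using G by (simp add: moment_empty prob_space)
    next
      case 2
      then obtain i where A: "A = {#i#}" using size_1_singleton_mset by blast
      show ?thesis
        unfolding A prod_power_count_singleton moment_singleton[OF G] using L by (simp add: has_limit_moments_def)
    next
      case 3
      then have "A \<noteq> {#}" by auto
      then show ?thesis using L 3 by (simp add: has_limit_moments_def moment_def limit_moment_eq[OF G] sum_count)
    qed
  qed
  then show ?R using conc by blast
next
  assume R: ?R
  have "(\<integral>x. x $ i \<partial>\<mu>) = stationary G $ i" for i
    using R[THEN conjunct2, rule_format, of "{#i#}"] unfolding prod_power_count_singleton moment_singleton[OF G] .
  moreover have "(\<integral>x. (\<Prod>k\<in>UNIV. x $ k ^ \<gamma> k) \<partial>\<mu>) = limit_moment G \<gamma>" if "(\<Sum>k\<in>UNIV. \<gamma> k) \<ge> 2" for \<gamma>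
  proof -
    obtain A where A: "\<gamma> = count A" using ex_multiset_count by blast
    with that have "A \<noteq> {#}" by auto
    then show ?thesis using R by (simp add: A limit_moment_eq[OF G] moment_def)
  qed
  ultimately show ?L using R by (simp add: has_limit_moments_def concentrated_on_def)
qed

theorem theorem1p3:
  fixes G :: "real^'m^'m" and \<zeta> :: real
  assumes "CARD('m) \<ge> 2"
    and "G \<in> generators"
    and "\<zeta> = 1"
  shows "\<exists>\<mu> :: (real^'m) measure.
    has_limit_moments G \<mu> \<and>
    (\<forall>\<mu>'. has_limit_moments G \<mu>' \<longrightarrow> \<mu>' = \<mu>) \<and>
    (\<forall>\<pi> :: 'm pmf.
       converges_in_distribution
         (\<lambda>n. distr (chain_law G \<zeta> \<pi>) borel (occupation n)) \<mu> \<and>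
       (\<forall>i. (\<lambda>n. \<integral>\<omega>. occupation n \<omega> $ i \<partial>chain_law G \<zeta> \<pi>)
              \<longlonglongrightarrow> stationary G $ i) \<and>
       (\<forall>\<gamma>. (\<Sum>k\<in>UNIV. \<gamma> k) \<ge> 2 \<longrightarrow>
          (\<lambda>n. \<integral>\<omega>. (\<Prod>k\<in>UNIV. (occupation n \<omega> $ k) ^ \<gamma> k) \<partial>chain_law G \<zeta> \<pi>)
            \<longlonglongrightarrow> limit_moment G \<gamma>))"
proof -
  note G = \<open>G \<in> generators\<close>
  define L where "L \<pi> = chain_law G 1 \<pi>" for \<pi>
  \<comment> \<open>Shifted by one, because \<open>occupation 0\<close> is the zero vector, which
    lies outside the simplex.\<close>
  define D where "D \<pi> n = distr (L \<pi>) borel (occupation (Suc n))" for \<pi> n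
  have L: "is_chain_law G 1 \<pi> (L \<pi>)" for \<pi>
    unfolding L_def by (rule is_chain_law_chain_law[OF G]) simp
  have occ: "occupation n \<in> borel_measurable (L \<pi>)" for n \<pi> by (rule occupation_measurable[OF L])
  have D: "concentrated_on prob_simplex (D \<pi> n)" for \<pi> n
  proof -
    interpret prob_space "L \<pi>" using L[of \<pi>] by (simp add: is_chain_law_def)
    have "closed (prob_simplex :: (real^'m) set)" by (rule compact_imp_closed[OF compact_prob_simplex])
    then have "AE x in D \<pi> n. x \<in> prob_simplex"
      unfolding D_def by (subst AE_distr_iff[OF occ]) (auto simp: occupation_in_simplex)
    then show ?thesis
      unfolding concentrated_on_def using prob_space_distr[OF occ] by (simp add: D_def)
  qed
  have mono_cont: "continuous_on UNIV (\<lambda>x :: real^'m. \<Prod>k\<in>UNIV. x $ k ^ \<gamma> k)" for \<gamma>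
    by (intro continuous_intros)
  have integral_D: "(\<integral>x. f x \<partial>D \<pi> n) = (\<integral>\<omega>. f (occupation (Suc n) \<omega>) \<partial>L \<pi>)"
    if "continuous_on UNIV f" for f :: "real^'m \<Rightarrow> real" and \<pi> n
    unfolding D_def by (rule integral_distr[OF occ borel_measurable_continuous_onI[OF that]])
  have mom: "(\<lambda>n. \<integral>\<omega>. (\<Prod>k\<in>UNIV. (occupation n \<omega> $ k) ^ count A k) \<partial>L \<pi>) \<longlonglongrightarrow> moment G A" for A \<pi>
    unfolding moment_def by (rule occupation_moment_tendsto[OF G L])
  have mom_D: "(\<lambda>n. \<integral>x. (\<Prod>k\<in>UNIV. x $ k ^ count A k) \<partial>D \<pi> n) \<longlonglongrightarrow> moment G A" for A \<pi>
    unfolding integral_D[OF mono_cont] by (rule LIMSEQ_Suc[OF mom])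
  have "prob_simplex \<noteq> ({} :: (real^'m) set)" using occupation_in_simplex[of 1] by blast
  \<comment> \<open>Any initial law could supply \<open>\<mu>\<close>: the limits of the moments do
    not involve it, so this one measure serves all chains.\<close>
  then obtain r \<mu> where r: "strict_mono (r :: nat \<Rightarrow> nat)" and \<mu>: "concentrated_on prob_simplex \<mu>"
    and conv: "\<And>f :: real^'m \<Rightarrow> real. continuous_on UNIV f \<Longrightarrow>
      (\<lambda>n. \<integral>x. f x \<partial>D (return_pmf undefined) (r n)) \<longlonglongrightarrow> (\<integral>x. f x \<partial>\<mu>)"
    using compact_support_convergent_subsequence[OF compact_prob_simplex, of "D (return_pmf undefined)"]
      D[of "return_pmf undefined"] unfolding concentrated_on_def by metis
  have \<mu>_mom: "(\<integral>x. (\<Prod>k\<in>UNIV. x $ k ^ count A k) \<partial>\<mu>) = moment G A" for A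
    using LIMSEQ_unique[OF conv[OF mono_cont] LIMSEQ_subseq_LIMSEQ[OF mom_D r, unfolded comp_def]] .
  have \<mu>_lim: "has_limit_moments G \<mu>" using \<mu> \<mu>_mom by (simp add: has_limit_moments_iff[OF G])
  moreover have "\<mu>' = \<mu>" if "has_limit_moments G \<mu>'" for \<mu>'
  proof (rule moments_determine_measure[OF compact_prob_simplex _ \<mu>])
    show "concentrated_on prob_simplex \<mu>'" using that by (simp add: has_limit_moments_iff[OF G])
    show "(\<integral>x. (\<Prod>k\<in>UNIV. x $ k ^ \<gamma> k) \<partial>\<mu>') = (\<integral>x. (\<Prod>k\<in>UNIV. x $ k ^ \<gamma> k) \<partial>\<mu>)" for \<gamma>
    proof -
      obtain A where "\<gamma> = count A" using ex_multiset_count by blast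
      then show ?thesis using that by (simp add: has_limit_moments_iff[OF G] \<mu>_mom)
    qed
  qed
  moreover have "converges_in_distribution (\<lambda>n. distr (L \<pi>) borel (occupation n)) \<mu>" for \<pi>
    unfolding converges_in_distribution_def
  proof (intro allI impI)
    fix f :: "real^'m \<Rightarrow> real" assume f: "continuous_on UNIV f \<and> bounded (range f)"
    have "(\<lambda>n. \<integral>x. f x \<partial>D \<pi> n) \<longlonglongrightarrow> (\<integral>x. f x \<partial>\<mu>)"
    proof (rule moments_convergence_imp_integral_convergence[OF compact_prob_simplex D \<mu>])
      fix \<gamma> :: "'m \<Rightarrow> nat"
      obtain A where "\<gamma> = count A" using ex_multiset_count by blast
      then show "(\<lambda>n. \<integral>x. (\<Prod>k\<in>UNIV. x $ k ^ \<gamma> k) \<partial>D \<pi> n) \<longlonglongrightarrow> (\<integral>x. (\<Prod>k\<in>UNIV. x $ k ^ \<gamma> k) \<partial>\<mu>)"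
        using mom_D by (simp add: \<mu>_mom)
    qed (use f in simp)
    then show "(\<lambda>n. \<integral>x. f x \<partial>distr (L \<pi>) borel (occupation n)) \<longlonglongrightarrow> (\<integral>x. f x \<partial>\<mu>)"
      unfolding D_def by (rule LIMSEQ_imp_Suc)
  qed
  moreover have "(\<lambda>n. \<integral>\<omega>. occupation n \<omega> $ i \<partial>L \<pi>) \<longlonglongrightarrow> stationary G $ i" for i \<pi>
    using mom[where A = "{#i#}"] unfolding prod_power_count_singleton moment_singleton[OF G] .
  moreover have "(\<lambda>n. \<integral>\<omega>. (\<Prod>k\<in>UNIV. (occupation n \<omega> $ k) ^ \<gamma> k) \<partial>L \<pi>) \<longlonglongrightarrow> limit_moment G \<gamma>"
    if "(\<Sum>k\<in>UNIV. \<gamma> k) \<ge> 2" for \<gamma> \<pi>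
  proof -
    obtain A where A: "\<gamma> = count A" using ex_multiset_count by blast
    with that have "A \<noteq> {#}" by auto
    then show ?thesis using mom[where A = A] by (simp add: A limit_moment_eq[OF G] moment_def)
  qed
  ultimately show ?thesis unfolding \<open>\<zeta> = 1\<close> L_def[symmetric] by (intro exI[of _ \<mu>]) blast
qed

end
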